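(* For every positive integer $n$ and every $\mathbf b=(b_1,\dots,b_n)\in\mathbb Z_{>0}^n$, the Ehrhart polynomial of $\mathfrak X_n(\mathbf b)$ is $$\mathrm{ehr}_{\mathfrak X_n(\mathbf b)}(t)=\sum_{\alpha\in\mathcal D(n)}\ \prod_{\emptyset\ne A\subseteq[n]}\binom{w_{|A|}(\mathbf b)\,t+\alpha_A-1}{\alpha_A},$$ where each factor is understood as the polynomial $\binom{y+\alpha-1}{\alpha}=\frac{y(y+1)\cdots(y+\alpha-1)}{\alpha!}$ evaluated at $y=w_{|A|}(\mathbf b)\,t$.
   Context: For $\mathbf b=(b_1,\dots,b_n)\in\mathbb Z_{>0}^n$, a $\mathbf b$-parking function is a list $(\beta_1,\dots,\beta_n)$ of positive integers whose nondecreasing rearrangement $\beta_1'\le\cdots\le\beta_n'$ satisfies $\beta_i'\le b_1+\cdots+b_i$ for all $i$. The $\mathbf b$-parking-function polytope $\mathfrak X_n(\mathbf b)\subset\mathbb R^n$ is the convex hull of all $\mathbf b$-parking functions of length $n$. For a lattice polytope $P\subset\mathbb R^n$, $\mathrm{ehr}_P(t)$ is the polynomial in $t$ that equals $\#(tP\cap\mathbb Z^n)$ at every positive integer $t$. $[n]=\{1,\dots,n\}$. Define $w_1(\mathbf b):=b_1-1$ and, for $2\le k\le n$, $w_k(\mathbf b):=\sum_{j=0}^{k-2}(-1)^j\binom{k-2}{j}b_{k-j}$. (These may be negative.) $\mathcal D(n)$ is the (finite) set of all sequences $\alpha=(\alpha_A)$ of nonnegative integers, indexed by the nonempty subsets $A\subseteq[n]$,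 such that $\sum_{A\in E}\alpha_A\le\bigl|\bigcup_{A\in E}A\bigr|$ for every nonempty collection $E$ of nonempty subsets of $[n]$. *)

theory Defs
  imports
    "HOL-Analysis.Analysis"
    "HOL-Library.Multiset"
    "HOL-Library.FuncSet"
    "HOL-Computational_Algebra.Polynomial"
begin

text \<open>
  The dimension n is the cardinality of the index type of the vectors. Sequences such as
  b are functions on the naturals of which only the values at 1, ..., n are used.
\<close>

definition rearrangement :: "nat ^ 'n::finite \<Rightarrow> nat list" where
  "rearrangement \<beta> = sorted_list_of_multiset (image_mset (\<lambda>i. \<beta> $ i) (mset_set UNIV))"

text \<open>
  The condition is invariant under permuting coordinates, so the index type needs no order.
  List positions start at 0, hence the shift by one.
\<close>

definition parking_function :: "(nat \<Rightarrow> nat) \<Rightarrow> nat ^ 'n::finite \<Rightarrow> bool" where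
  "parking_function b \<beta> \<longleftrightarrow>
     (\<forall>i. 0 < \<beta> $ i) \<and>
     (\<forall>i\<in>{1..CARD('n)}. rearrangement \<beta> ! (i - 1) \<le> (\<Sum>j=1..i. b j))"

definition parking_polytope :: "(nat \<Rightarrow> nat) \<Rightarrow> (real ^ 'n::finite) set" where
  "parking_polytope b = convex hull {(\<chi> i. real (\<beta> $ i)) | \<beta>. parking_function b \<beta>}"

definition lattice_points :: "(real ^ 'n::finite) set \<Rightarrow> (real ^ 'n) set" where
  "lattice_points S = {x \<in> S. \<forall>i. x $ i \<in> \<int>}"

definition is_ehrhart_poly :: "(real ^ 'n::finite) set \<Rightarrow> real poly \<Rightarrow> bool" where
  "is_ehrhart_poly P p \<longleftrightarrow>
     (\<forall>t::nat. 0 < t \<longrightarrow>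
        poly p (real t) = real (card (lattice_points ((\<lambda>x. real t *\<^sub>R x) ` P))))"

definition ehrhart_poly :: "(real ^ 'n::finite) set \<Rightarrow> real poly" where
  "ehrhart_poly P = (THE p. is_ehrhart_poly P p)"

lemma is_ehrhart_poly_unique:
  assumes "is_ehrhart_poly P p" "is_ehrhart_poly P q"
  shows "p = q"
proof (rule ccontr)
  assume "p \<noteq> q"
  then have "finite {x. poly (p - q) x = 0}"
    by (intro poly_roots_finite) simp
  moreover have "real ` {0<..} \<subseteq> {x. poly (p - q) x = 0}"
    using assms by (auto simp: is_ehrhart_poly_def)
  ultimately have "finite (real ` {0<..})"
    by (rule finite_subset[rotated])
  then show False
    by (simp add: finite_image_iff infinite_Ioi)
qed

lemma ehrhart_poly_eqI: "is_ehrhart_poly P p \<Longrightarrow> ehrhart_poly P = p"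
  unfolding ehrhart_poly_def by (blast intro: is_ehrhart_poly_unique)

text \<open>Only used for positive k; the value at k = 0 is irrelevant.\<close>

definition w :: "(nat \<Rightarrow> nat) \<Rightarrow> nat \<Rightarrow> int" where
  "w b k =
     (if k = 1 then int (b 1) - 1
      else (\<Sum>j=0..k-2. (-1) ^ j * int ((k - 2) choose j) * int (b (k - j))))"

definition nonempty_subsets :: "nat \<Rightarrow> nat set set" where
  "nonempty_subsets n = Pow {1..n} - {{}}"

text \<open>
  The extensional function space makes each family of integers indexed by the nonempty
  subsets occur exactly once.
\<close>

definition D :: "nat \<Rightarrow> (nat set \<Rightarrow> nat) set" where
  "D n = {\<alpha> \<in> nonempty_subsets n \<rightarrow>\<^sub>E UNIV.
     \<forall>E. E \<noteq> {} \<and> E \<subseteq> nonempty_subsets n \<longrightarrow> (\<Sum>A\<in>E. \<alpha> A) \<le> card (\<Union>E)}"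

lemma finite_D: "finite (D n)"
proof (rule finite_subset)
  show "D n \<subseteq> nonempty_subsets n \<rightarrow>\<^sub>E {0..n}"
  proof
    fix \<alpha> assume \<alpha>: "\<alpha> \<in> D n"
    have "\<alpha> A \<le> n" if A: "A \<in> nonempty_subsets n" for A
    proof -
      have "(\<Sum>A\<in>{A}. \<alpha> A) \<le> card (\<Union>{A})"
        using \<alpha> A unfolding D_def by blast
      also have "\<dots> \<le> card {1..n}"
        using A by (intro card_mono) (auto simp: nonempty_subsets_def)
      finally show ?thesis by simp
    qed
    then show "\<alpha> \<in> nonempty_subsets n \<rightarrow>\<^sub>E {0..n}"
      using \<alpha> unfolding D_def by (auto simp: PiE_iff)
  qed
  show "finite (nonempty_subsets n \<rightarrow>\<^sub>E {0..n})"
    by (intro finite_PiE) (auto simp: nonempty_subsets_def)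
qed

end

theory Submission
  imports Defs "HOL-Library.Nat_Bijection"
begin

text \<open>
  Subtracting \<open>t\<close> from every coordinate turns the \<open>t\<close>-th dilate of the polytope into the symmetric
  polymatroid of all \<open>y \<ge> 0\<close> such that the sum of \<open>y\<close> over any index set \<open>S\<close> is at most the sum of the \<open>card S\<close>
  largest numbers \<open>c\<^sub>m = t (b\<^sub>1 + \<dots> + b\<^sub>m - 1)\<close>. The inclusion of the polymatroid in the polytope is
  the greedy algorithm (\<open>parking_polymatroid_greedy\<close>) combined with a separating hyperplane. So the
  Ehrhart polynomial counts the integer vectors weakly majorized by \<open>c\<close>. Binomial inversion
  gives \<open>c\<^sub>m = \<Sum>\<^sub>j (m-1 choose j-1) t w\<^sub>j\<close>, which says that the bound for \<open>S\<close> is the sum of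
  \<open>t w\<^bsub>card A\<^esub>\<close> over all nonempty sets \<open>A\<close> that meet \<open>S\<close>.

  Suppose first that all \<open>t w\<^sub>j\<close> are nonnegative, and take \<open>t w\<^bsub>card A\<^esub>\<close> copies of every \<open>A\<close>. In the
  bipartite graph between copies and elements, the vectors to be counted are the \<open>y\<close> on the elements
  with \<open>y(S) \<le> card (N(S))\<close> for all \<open>S\<close>. The vectors \<open>\<beta>\<close> on the copies with \<open>\<beta>(J) \<le> card (N(J))\<close> for
  all \<open>J\<close> are counted by the right-hand side: the totals over the copies of each \<open>A\<close> form an element
  \<open>\<alpha>\<close> of \<open>D n\<close>, and the binomial coefficients count the distributions of the \<open>\<alpha> A\<close> over the
  copies. It remains to see that the two sides of a bipartite graph carry equally many such vectors
  (\<open>card_degree_vectors_converse\<close>). This is the duality of hypertrees due to Postnikov and Kalman.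
  Add one vertex to each side, adjacent to everything on the other side. Then both sides
  are in bijection with one and the same set of spanning trees \<open>F\<close>, by taking degrees minus one at
  the vertices of that side. The trees are singled out by a generic cost function on the
  edges: every set of edges in \<open>F\<close> is strictly cheaper than any other set of edges with the same
  degrees. They correspond to the simplices of a regular triangulation of the root
  polytope. The tree of a hypertree is the support of a cheapest integral transport plan for supplies
  and demands that are perturbed so that they force the support to be a spanning tree.

  Negative \<open>w\<^sub>j\<close> are reached by polynomiality. Removing the last coordinate of a weakly
  majorized vector yields a recursion whose steps are polynomial sums
  (\<open>card_weakly_majorized_Suc\<close>), so the number of vectors weakly majorized by \<open>c\<close> is one polynomial
  in \<open>c\<close> on the whole cone of nondecreasing \<open>c \<ge> 0\<close>. Moving from \<open>w\<close> in the direction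
  \<open>(1, \<dots>, 1)\<close> stays in this cone and ends in the nonnegative case, so both sides agree at
  infinitely many points of a line and hence at \<open>w\<close> itself.
\<close>

section \<open>Circulations and forests in bipartite graphs\<close>

text \<open>
  Gaussian elimination of one equation and one unknown at a time.
\<close>

lemma homogeneous_system_nontrivial:
  fixes m :: "'a \<Rightarrow> 'b \<Rightarrow> real"
  assumes "finite B" "finite A" "card B < card A"
  shows "\<exists>d. (\<exists>a\<in>A. d a \<noteq> 0) \<and> (\<forall>b\<in>B. (\<Sum>a\<in>A. d a * m a b) = 0)"
  using assms
proof (induction B arbitrary: A m rule: finite_induct)
  case empty
  then have "A \<noteq> {}" by auto
  then show ?case by (intro exI[of _ "\<lambda>_. 1"]) auto
next
  case (insert b B)
  show ?case
  proof (cases "\<forall>a\<in>A. m a b = 0")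
    case True
    obtain d where "\<exists>a\<in>A. d a \<noteq> 0" "\<forall>b\<in>B. (\<Sum>a\<in>A. d a * m a b) = 0"
      using insert.IH[of A m] insert.prems insert.hyps by auto
    then show ?thesis using True by (intro exI[of _ d]) auto
  next
    case False
    then obtain p where p: "p \<in> A" "m p b \<noteq> 0" by auto
    define A' where "A' = A - {p}"
    have A': "finite A'" "card B < card A'" "A = insert p A'" "p \<notin> A'"
      using insert.prems insert.hyps p by (auto simp: A'_def)
    obtain d where d: "\<exists>a\<in>A'. d a \<noteq> 0"
      "\<forall>b'\<in>B. (\<Sum>a\<in>A'. d a * (m a b' - m a b / m p b * m p b')) = 0"
      using insert.IH[of A' "\<lambda>a b'. m a b' - m a b / m p b * m p b'"] A' by blast
    define q where "q = - (\<Sum>a\<in>A'. d a * m a b) / m p b"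
    \<comment> \<open>\<open>q\<close> makes the eliminated equation hold; the others hold because the reduced system has
      the column of the pivot subtracted.\<close>
    define d' where "d' = d(p := q)"
    have sum_d': "(\<Sum>a\<in>A. d' a * m a b') = q * m p b' + (\<Sum>a\<in>A'. d a * m a b')" for b'
    proof -
      have "(\<Sum>a\<in>A'. d' a * m a b') = (\<Sum>a\<in>A'. d a * m a b')"
        using A' by (intro sum.cong) (auto simp: d'_def)
      then show ?thesis using A' by (simp add: d'_def)
    qed
    have "(\<Sum>a\<in>A. d' a * m a b) = 0"
      unfolding sum_d' q_def using p by simp
    moreover have "(\<Sum>a\<in>A. d' a * m a b') = 0" if "b' \<in> B" for b'
    proof -
      have "0 = (\<Sum>a\<in>A'. d a * m a b') - (\<Sum>a\<in>A'. d a * m a b) * (m p b' / m p b)"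
        using d(2) that
        by (simp add: right_diff_distrib sum_subtractf sum_distrib_left divide_inverse ac_simps)
      then show ?thesis unfolding sum_d' q_def by (simp add: divide_inverse ac_simps)
    qed
    moreover have "\<exists>a\<in>A. d' a \<noteq> 0" using d(1) A' by (auto simp: d'_def)
    ultimately show ?thesis by (intro exI[of _ d']) auto
  qed
qed

text \<open>
  Two sets of edges with equal degrees differ by a circulation with entries in \<open>{-1, 0, 1}\<close>. All
  exchange arguments on cycles below only need this.
\<close>

definition same_degrees :: "('a \<times> 'b) set \<Rightarrow> ('a \<times> 'b) set \<Rightarrow> bool" where
  "same_degrees M M' \<longleftrightarrow>
     (\<forall>a. card (M `` {a}) = card (M' `` {a})) \<and> (\<forall>b. card (M\<inverse> `` {b}) = card (M'\<inverse> `` {b}))"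

lemma same_degrees_sym: "same_degrees M M' \<Longrightarrow> same_degrees M' M"
  by (simp add: same_degrees_def)

lemma same_degrees_converse: "same_degrees (M\<inverse>) (M'\<inverse>) \<longleftrightarrow> same_degrees M M'"
  by (auto simp: same_degrees_def)

lemma sum_zero_sign_change:
  fixes g :: "'a \<Rightarrow> real"
  assumes "finite A" "(\<Sum>a\<in>A. g a) = 0" "a \<in> A" "g a \<noteq> 0"
  shows "\<exists>a\<in>A. g a < 0" "\<exists>a\<in>A. g a > 0"
proof -
  show "\<exists>a\<in>A. g a < 0"
  proof (rule ccontr)
    assume "\<not> ?thesis"
    then have "\<forall>a\<in>A. 0 \<le> g a" by (auto simp: not_less)
    then show False using assms sum_nonneg_eq_0_iff[of A g] by auto
  qed
  show "\<exists>a\<in>A. g a > 0"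
  proof (rule ccontr)
    assume "\<not> ?thesis"
    then have "\<forall>a\<in>A. g a \<le> 0" by (auto simp: not_less)
    then show False using assms sum_nonneg_eq_0_iff[of A "\<lambda>a. - g a"] by (auto simp: sum_negf)
  qed
qed

text \<open>
  Walk alternately along negative and positive entries of the circulation. A minimal set \<open>U\<close> of columns
  that is closed under this walk is permuted by it, so it traces out disjoint cycles whose positive
  and negative edges are perfect matchings of the same vertices.
\<close>

lemma circulation_contains_signed_cycle:
  fixes d :: "'a \<Rightarrow> 'b \<Rightarrow> real"
  assumes fin: "finite X" "finite Y"
    and row: "\<And>a. a \<in> X \<Longrightarrow> (\<Sum>b\<in>Y. d a b) = 0"
    and col: "\<And>b. b \<in> Y \<Longrightarrow> (\<Sum>a\<in>X. d a b) = 0"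
    and nz: "a0 \<in> X" "b0 \<in> Y" "d a0 b0 \<noteq> 0"
  obtains M M' where "M \<noteq> {}" "M \<subseteq> {(a, b). a \<in> X \<and> b \<in> Y \<and> d a b > 0}"
    "M' \<subseteq> {(a, b). a \<in> X \<and> b \<in> Y \<and> d a b < 0}" "same_degrees M M'"
proof -
  define Z where "Z = {b\<in>Y. \<exists>a\<in>X. d a b \<noteq> 0}"
  have "\<forall>b\<in>Z. \<exists>a\<in>X. d a b < 0"
    using sum_zero_sign_change(1)[OF fin(1) col] by (auto simp: Z_def)
  then obtain neg where neg: "\<And>b. b \<in> Z \<Longrightarrow> neg b \<in> X \<and> d (neg b) b < 0" by metis
  have "\<forall>b\<in>Z. \<exists>b'\<in>Y. d (neg b) b' > 0"
  proof
    fix b assume b: "b \<in> Z"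
    then have "b \<in> Y" by (simp add: Z_def)
    then show "\<exists>b'\<in>Y. d (neg b) b' > 0"
      using sum_zero_sign_change(2)[OF fin(2) row, of "neg b" b] neg[OF b] by auto
  qed
  then have "\<forall>a\<in>neg ` Z. \<exists>b'\<in>Y. d a b' > 0" by auto
  then obtain pos where pos': "\<And>a. a \<in> neg ` Z \<Longrightarrow> pos a \<in> Y \<and> d a (pos a) > 0" by metis
  have pos: "pos (neg b) \<in> Z" if "b \<in> Z" for b
    using pos'[of "neg b"] neg[OF that] that by (force simp: Z_def)
  define f where "f = pos \<circ> neg"
  have "Z \<noteq> {}" "finite Z" using nz fin by (auto simp: Z_def)
  define invariant where "invariant U \<longleftrightarrow> U \<noteq> {} \<and> U \<subseteq> Z \<and> f ` U \<subseteq> U" for U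
  have "invariant Z" using \<open>Z \<noteq> {}\<close> pos by (auto simp: invariant_def f_def)
  then obtain U where U: "invariant U" "\<And>U'. invariant U' \<Longrightarrow> card U \<le> card U'"
    using ex_has_least_nat[of invariant Z card] by auto
  have finU: "finite U" using U(1) \<open>finite Z\<close> finite_subset by (auto simp: invariant_def)
  have "invariant (f ` U)" using U(1) by (auto simp: invariant_def)
  then have fU: "f ` U = U"
    using U finU by (intro card_subset_eq) (auto simp: invariant_def card_image_le le_antisym)
  then have injf: "inj_on f U" by (intro eq_card_imp_inj_on[OF finU]) simp
  have injn: "inj_on neg U" using injf by (auto simp: f_def inj_on_def)
  have injp: "inj_on pos (neg ` U)"
    using injf unfolding f_def by (rule comp_inj_on_iff[THEN iffD2, OF injn, rotated] inj_on_imageI)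
  have UZ: "U \<subseteq> Z" "U \<noteq> {}" using U by (auto simp: invariant_def)
  define M where "M = (\<lambda>a. (a, pos a)) ` neg ` U"
  define M' where "M' = (\<lambda>b. (neg b, b)) ` U"
  have 1: "card (M `` {a}) = of_bool (a \<in> neg ` U)" for a
  proof -
    have "M `` {a} = (if a \<in> neg ` U then {pos a} else {})" by (auto simp: M_def)
    then show ?thesis by simp
  qed
  have 2: "card (M' `` {a}) = of_bool (a \<in> neg ` U)" for a
  proof (cases "a \<in> neg ` U")
    case True
    then obtain b where b: "b \<in> U" "a = neg b" by auto
    then have "M' `` {a} = {b}" using injn by (auto simp: M'_def inj_on_def)
    then show ?thesis using True by simp
  next
    case False
    then have "M' `` {a} = {}" by (auto simp: M'_def)
    then show ?thesis using False by (metis card.empty of_bool_eq(1))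
  qed
  have 3: "card (M\<inverse> `` {b}) = of_bool (b \<in> U)" for b
  proof (cases "b \<in> U")
    case True
    then obtain b' where b: "b' \<in> U" "b = pos (neg b')" using fU by (auto simp: f_def)
    have "a = neg b'" if "a \<in> neg ` U" "pos a = b" for a
      using inj_onD[OF injp _ that(1), of "neg b'"] that(2) b by simp
    moreover have "M\<inverse> `` {b} = {a \<in> neg ` U. pos a = b}" unfolding M_def by blast
    ultimately have "M\<inverse> `` {b} = {neg b'}" using b by blast
    then show ?thesis using True by simp
  next
    case False
    then have "M\<inverse> `` {b} = {}" using fU by (auto simp: M_def f_def)
    then show ?thesis using False by (metis card.empty of_bool_eq(1))
  qed
  have 4: "card (M'\<inverse> `` {b}) = of_bool (b \<in> U)" for b
  proof -
    have "M'\<inverse> `` {b} = (if b \<in> U then {neg b} else {})" by (auto simp: M'_def)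
    then show ?thesis by simp
  qed
  show ?thesis
  proof
    show "M \<noteq> {}" using UZ by (auto simp: M_def)
    show "M \<subseteq> {(a, b). a \<in> X \<and> b \<in> Y \<and> d a b > 0}"
      using UZ pos' neg by (fastforce simp: M_def)
    show "M' \<subseteq> {(a, b). a \<in> X \<and> b \<in> Y \<and> d a b < 0}"
      using UZ neg by (auto simp: M'_def Z_def)
    show "same_degrees M M'" by (simp only: same_degrees_def 1 2 3 4) simp
  qed
qed

text \<open>
  For a set of edges of a bipartite graph this means being a forest: along a cycle, the odd and
  the even edges have the same degrees.
\<close>

definition degree_determined :: "('a \<times> 'b) set \<Rightarrow> bool" where
  "degree_determined F \<longleftrightarrow> (\<forall>M\<subseteq>F. \<forall>M'\<subseteq>F. same_degrees M M' \<longrightarrow> M = M')"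

text \<open>
  More edges than that leave room for a nonzero circulation supported on \<open>F\<close>, since one of
  the degree equations is implied by the others. A signed cycle in it contradicts
  \<open>degree_determined\<close>.
\<close>

lemma forest_bound:
  fixes F :: "('a \<times> 'b) set"
  assumes fin: "finite X" "finite Y" and ne: "X \<noteq> {}" "Y \<noteq> {}"
    and F: "F \<subseteq> X \<times> Y" "degree_determined F"
  shows "card F < card X + card Y"
proof (rule ccontr)
  assume large: "\<not> ?thesis"
  obtain y0 where y0: "y0 \<in> Y" using ne by auto
  have finF: "finite F" using F fin by (meson finite_SigmaI finite_subset)
  define B where "B = Inl ` X \<union> Inr ` (Y - {y0})"
  define m :: "'a \<times> 'b \<Rightarrow> 'a + 'b \<Rightarrow> real"
    where "m e v = (case v of Inl a \<Rightarrow> of_bool (fst e = a) | Inr b \<Rightarrow> of_bool (snd e = b))" for e v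
  have "card B = card X + card (Y - {y0})"
    unfolding B_def using fin by (subst card_Un_disjoint) (auto simp: card_image)
  moreover have "card (Y - {y0}) < card Y" using y0 fin by (intro psubset_card_mono) auto
  ultimately have "card B < card F" using large by linarith
  moreover have "finite B" using fin by (simp add: B_def)
  ultimately obtain z where z: "\<exists>e\<in>F. z e \<noteq> 0" "\<forall>v\<in>B. (\<Sum>e\<in>F. z e * m e v) = 0"
    using homogeneous_system_nontrivial[of B F m] finF by blast
  define d where "d a b = (if (a, b) \<in> F then z (a, b) else 0)" for a b
  have sumF: "(\<Sum>e\<in>F. z e * h e) = (\<Sum>a\<in>X. \<Sum>b\<in>Y. d a b * h (a, b))" for h :: "_ \<Rightarrow> real"
  proof -
    have "(\<Sum>e\<in>F. z e * h e) = (\<Sum>e\<in>X\<times>Y. (case e of (a, b) \<Rightarrow> d a b) * h e)"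
      using F(1) fin by (intro sum.mono_neutral_cong_left) (auto simp: d_def)
    also have "\<dots> = (\<Sum>a\<in>X. \<Sum>b\<in>Y. d a b * h (a, b))"
      by (simp add: sum.cartesian_product split_def)
    finally show ?thesis .
  qed
  have row: "(\<Sum>b\<in>Y. d a b) = 0" if "a \<in> X" for a
  proof -
    have "(\<Sum>e\<in>F. z e * m e (Inl a)) = 0" using z(2) that by (auto simp: B_def)
    then have "(\<Sum>a'\<in>X. \<Sum>b\<in>Y. d a' b * of_bool (a' = a)) = 0"
      unfolding sumF by (simp add: m_def)
    then show ?thesis using that fin by (simp add: sum.delta flip: sum_distrib_right)
  qed
  have col': "(\<Sum>a\<in>X. d a b) = 0" if "b \<in> Y" "b \<noteq> y0" for b
  proof -
    have "(\<Sum>e\<in>F. z e * m e (Inr b)) = 0" using z(2) that by (auto simp: B_def)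
    then have "(\<Sum>a\<in>X. \<Sum>b'\<in>Y. d a b' * of_bool (b' = b)) = 0"
      unfolding sumF by (simp add: m_def)
    then show ?thesis using that fin by simp
  qed
  have col: "(\<Sum>a\<in>X. d a b) = 0" if "b \<in> Y" for b
  proof (cases "b = y0")
    case True
    have "0 = (\<Sum>b\<in>Y. \<Sum>a\<in>X. d a b)" using row by (subst sum.swap) simp
    also have "\<dots> = (\<Sum>a\<in>X. d a y0)"
      using fin y0 col' by (subst sum.remove[of _ y0]) auto
    finally show ?thesis using True by simp
  qed (use col' that in auto)
  obtain a0 b0 where "(a0, b0) \<in> F" "z (a0, b0) \<noteq> 0" using z(1) by auto
  then have nz: "a0 \<in> X" "b0 \<in> Y" "d a0 b0 \<noteq> 0" using F by (auto simp: d_def)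
  obtain M M' where M: "M \<noteq> {}" "M \<subseteq> {(a, b). a \<in> X \<and> b \<in> Y \<and> d a b > 0}"
    "M' \<subseteq> {(a, b). a \<in> X \<and> b \<in> Y \<and> d a b < 0}" "same_degrees M M'"
    by (rule circulation_contains_signed_cycle[OF fin row col nz])
  have "M \<subseteq> F" "M' \<subseteq> F" using M by (auto simp: d_def split: if_splits)
  then have "M = M'" using F(2) M(4) by (auto simp: degree_determined_def)
  then show False using M(1-3) by force
qed

section \<open>Integral transport plans\<close>

text \<open>
  Hall's theorem with multiplicities. One unit can always be shipped from a vertex \<open>x\<close> along some edge
  without violating the condition: otherwise every usable neighbour of \<open>x\<close> lies in the
  neighbourhood of a tight set avoiding \<open>x\<close>. Tight sets are closed under union, so a single tight set
  \<open>J\<close> covers all of these neighbours, and then \<open>insert x J\<close> violates the condition.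
\<close>

lemma integral_transport:
  fixes s :: "'a \<Rightarrow> nat" and t :: "'b \<Rightarrow> nat"
  assumes fin: "finite X" "finite Y" and E: "E \<subseteq> X \<times> Y"
    and hall: "\<And>J. J \<subseteq> X \<Longrightarrow> sum s J \<le> sum t (E `` J)"
  shows "\<exists>f. (\<forall>a b. (a, b) \<notin> E \<longrightarrow> f a b = 0) \<and> (\<forall>a\<in>X. (\<Sum>b\<in>Y. f a b) = s a) \<and>
    (\<forall>b\<in>Y. (\<Sum>a\<in>X. f a b) \<le> t b)"
  using hall
proof (induction "sum s X" arbitrary: s t)
  case 0
  then show ?case using fin by (intro exI[of _ "\<lambda>_ _. 0"]) auto
next
  case (Suc k)
  note hall = Suc.prems
  have finE: "finite (E `` J)" for J using E by (intro finite_subset[OF _ fin(2)]) blast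
  obtain x where x: "x \<in> X" "s x > 0"
    using Suc.hyps(2) by (metis sum.neutral neq0_conv old.nat.distinct(1))
  have "\<exists>y\<in>E``{x}. t y > 0 \<and> (\<forall>J\<subseteq>X. x \<notin> J \<longrightarrow> y \<in> E `` J \<longrightarrow> sum s J < sum t (E `` J))"
  proof (rule ccontr)
    assume contra: "\<not> ?thesis"
    define W where "W = {y\<in>E``{x}. t y > 0}"
    define tight where "tight J \<longleftrightarrow> J \<subseteq> X \<and> x \<notin> J \<and> sum s J = sum t (E `` J)" for J
    have ex: "\<exists>J. tight J \<and> y \<in> E `` J" if "y \<in> W" for y
    proof -
      have "y \<in> E `` {x}" "t y > 0" using that by (auto simp: W_def)
      then have "\<not> (\<forall>J\<subseteq>X. x \<notin> J \<longrightarrow> y \<in> E `` J \<longrightarrow> sum s J < sum t (E `` J))"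
        using contra by blast
      then obtain J where "J \<subseteq> X" "x \<notin> J" "y \<in> E `` J" "\<not> sum s J < sum t (E `` J)"
        by blast
      moreover from this have "sum s J = sum t (E `` J)" using hall[of J] by linarith
      ultimately show ?thesis unfolding tight_def by blast
    qed
    have union: "tight (J \<union> J')" if "tight J" "tight J'" for J J'
    proof -
      have fJ: "finite J" "finite J'" using that fin finite_subset by (auto simp: tight_def)
      have "sum s (J \<union> J') + sum s (J \<inter> J') = sum t (E `` J) + sum t (E `` J')"
        using sum.union_inter[OF fJ, of s] that by (simp add: tight_def)
      also have "\<dots> = sum t (E `` J \<union> E `` J') + sum t (E `` J \<inter> E `` J')"
        using finE by (simp add: sum.union_inter)
      finally have 1: "sum s (J \<union> J') + sum s (J \<inter> J') = 
        sum t (E `` (J \<union> J')) + sum t (E `` J \<inter> E `` J')" by (simp add: Image_Un)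
      have 2: "sum t (E `` (J \<inter> J')) \<le> sum t (E `` J \<inter> E `` J')"
        using finE by (intro sum_mono2) auto
      have 3: "sum s (J \<inter> J') \<le> sum t (E `` (J \<inter> J'))"
        using that by (intro hall) (auto simp: tight_def)
      from 1 2 3 have "sum s (J \<union> J') \<ge> sum t (E `` (J \<union> J'))" by linarith
      then show ?thesis using that hall[of "J \<union> J'"] by (auto simp: tight_def)
    qed
    have "finite W" using finE[of "{x}"] by (rule finite_subset[rotated]) (auto simp: W_def)
    have "\<exists>J. tight J \<and> U \<subseteq> E `` J" if "finite U" "U \<subseteq> W" for U
      using that
    proof (induction rule: finite_induct)
      case empty
      show ?case by (intro exI[of _ "{}"]) (auto simp: tight_def)
    next
      case (insert y U)
      then obtain J where J: "tight J" "U \<subseteq> E `` J" by auto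
      obtain J' where J': "tight J'" "y \<in> E `` J'" using insert.prems ex[of y] by blast
      have "insert y U \<subseteq> E `` (J \<union> J')" using J J' by blast
      then show ?case using union[OF J(1) J'(1)] by blast
    qed
    then obtain J where J: "tight J" "W \<subseteq> E `` J" using \<open>finite W\<close> by blast
    have "sum t (E `` insert x J) = sum t (E `` J)"
    proof (rule sum.mono_neutral_right)
      show "\<forall>y\<in>E `` insert x J - E `` J. t y = 0"
      proof
        fix y assume y: "y \<in> E `` insert x J - E `` J"
        then have "y \<in> E `` {x}" "y \<notin> W" using J(2) by blast+
        then show "t y = 0" by (simp add: W_def)
      qed
    qed (use finE in auto)
    moreover have "sum s (insert x J) = s x + sum s J"
      using J(1) finite_subset[OF _ fin(1), of J] by (simp add: tight_def)
    ultimately show False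
      using hall[of "insert x J"] J(1) x by (auto simp: tight_def)
  qed
  then obtain y where y: "(x, y) \<in> E" "t y > 0"
    and strict: "\<And>J. J \<subseteq> X \<Longrightarrow> x \<notin> J \<Longrightarrow> y \<in> E `` J \<Longrightarrow> sum s J < sum t (E `` J)"
    by auto
  define s' where "s' = s(x := s x - 1)"
  define t' where "t' = t(y := t y - 1)"
  have s': "sum s J = sum s' J + of_bool (x \<in> J)" if "finite J" for J
  proof (cases "x \<in> J")
    case True
    then show ?thesis using that x by (simp add: sum.remove[of J x] s'_def)
  next
    case False
    then have "sum s J = sum s' J" by (intro sum.cong) (auto simp: s'_def)
    then show ?thesis using False by simp
  qed
  have t': "sum t J = sum t' J + of_bool (y \<in> J)" if "finite J" for J
  proof (cases "y \<in> J")
    case True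
    then show ?thesis using that y by (simp add: sum.remove[of J y] t'_def)
  next
    case False
    then have "sum t J = sum t' J" by (intro sum.cong) (auto simp: t'_def)
    then show ?thesis using False by simp
  qed
  have "k = sum s' X" using s'[of X] fin x Suc.hyps(2) by simp
  moreover have "sum s' J \<le> sum t' (E `` J)" if "J \<subseteq> X" for J
  proof -
    have "finite J" using that fin finite_subset by auto
    then show ?thesis
      using hall[OF that] strict[OF that] s'[of J] t'[OF finE, of J] y
      by (cases "x \<in> J"; cases "y \<in> E `` J") auto
  qed
  ultimately obtain f where f: "\<forall>a b. (a, b) \<notin> E \<longrightarrow> f a b = 0"
    "\<forall>a\<in>X. (\<Sum>b\<in>Y. f a b) = s' a" "\<forall>b\<in>Y. (\<Sum>a\<in>X. f a b) \<le> t' b"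
    using Suc.hyps(1)[of s' t'] by blast
  define g where "g a b = f a b + of_bool (a = x \<and> b = y)" for a b
  have xy: "x \<in> X" "y \<in> Y" using y E by auto
  have "(\<Sum>b\<in>Y. g a b) = s a" if "a \<in> X" for a
  proof -
    have "(\<Sum>b\<in>Y. g a b) = s' a + (\<Sum>b\<in>Y. of_bool (a = x \<and> b = y))"
      using f(2) that by (simp add: g_def sum.distrib)
    also have "(\<Sum>b\<in>Y. of_bool (a = x \<and> b = y)) = (of_bool (a = x) :: nat)"
      using fin xy by (cases "a = x") auto
    finally show ?thesis using x by (auto simp: s'_def)
  qed
  moreover have "(\<Sum>a\<in>X. g a b) \<le> t b" if "b \<in> Y" for b
  proof -
    have "(\<Sum>a\<in>X. g a b) \<le> t' b + (\<Sum>a\<in>X. of_bool (a = x \<and> b = y))"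
      using f(3) that by (simp add: g_def sum.distrib)
    also have "(\<Sum>a\<in>X. of_bool (a = x \<and> b = y)) = (of_bool (b = y) :: nat)"
      using fin xy by (cases "b = y") auto
    finally show ?thesis using y by (cases "b = y") (auto simp: t'_def)
  qed
  ultimately show ?case using f(1) y by (intro exI[of _ g]) (auto simp: g_def)
qed

section \<open>Hypertrees and cheap spanning trees\<close>

text \<open>
  For connected \<open>E\<close> these are the vectors of degrees minus one, at the vertices in \<open>X\<close>, of the
  spanning trees of \<open>E\<close>. The description by inequalities is the one that occurs in the application.
\<close>

definition hypertrees :: "'a set \<Rightarrow> 'b set \<Rightarrow> ('a \<times> 'b) set \<Rightarrow> ('a \<Rightarrow> nat) set" where
  "hypertrees X Y E = {\<beta> \<in> X \<rightarrow>\<^sub>E UNIV. sum \<beta> X + 1 = card Y \<and>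
     (\<forall>J\<subseteq>X. J \<noteq> {} \<longrightarrow> sum \<beta> J < card (E `` J))}"

definition generic_cost :: "('a \<times> 'b) set \<Rightarrow> ('a \<times> 'b \<Rightarrow> nat) \<Rightarrow> bool" where
  "generic_cost E c \<longleftrightarrow> inj_on (sum c) (Pow E)"

text \<open>
  Linear programming would express the same optimality by potentials on the vertices. The exchange
  condition is passed on to subsets of \<open>F\<close> and can be compared directly between two sets.
\<close>

definition cheap :: "('a \<times> 'b \<Rightarrow> nat) \<Rightarrow> ('a \<times> 'b) set \<Rightarrow> ('a \<times> 'b) set \<Rightarrow> bool" where
  "cheap c E F \<longleftrightarrow> (\<forall>M\<subseteq>F. \<forall>M'\<subseteq>E. same_degrees M M' \<and> M \<noteq> M' \<longrightarrow> sum c M < sum c M')"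

text \<open>
  This definition is symmetric in \<open>X\<close> and \<open>Y\<close>, which is the whole point: it makes the number of
  hypertrees on \<open>X\<close> equal to that on \<open>Y\<close>.
\<close>

definition cheap_trees ::
  "('a \<times> 'b \<Rightarrow> nat) \<Rightarrow> 'a set \<Rightarrow> 'b set \<Rightarrow> ('a \<times> 'b) set \<Rightarrow> ('a \<times> 'b) set set" where
  "cheap_trees c X Y E = {F. F \<subseteq> E \<and> cheap c E F \<and> card F + 1 = card X + card Y \<and>
     (\<forall>a\<in>X. F `` {a} \<noteq> {}) \<and> (\<forall>b\<in>Y. F\<inverse> `` {b} \<noteq> {})}"

text \<open>
  Distinct powers of two as costs: binary expansions are unique.
\<close>

lemma ex_generic_cost:
  assumes "finite E"
  obtains c :: "'a \<times> 'b \<Rightarrow> nat" where "generic_cost E c"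
proof -
  obtain n and g :: "'a \<times> 'b \<Rightarrow> nat" where g: "inj_on g E"
    using finite_imp_inj_to_nat_seg[OF assms] by auto
  have eq: "sum (\<lambda>e. 2 ^ g e) M = set_encode (g ` M)" if "M \<subseteq> E" for M
    using inj_on_subset[OF g that] by (simp add: set_encode_def sum.reindex)
  have "inj_on (sum (\<lambda>e. 2 ^ g e :: nat)) (Pow E)"
  proof (rule inj_onI)
    fix M M' :: "('a \<times> 'b) set" assume M: "M \<in> Pow E" "M' \<in> Pow E"
      and "sum (\<lambda>e. 2 ^ g e) M = (sum (\<lambda>e. 2 ^ g e) M' :: nat)"
    then have "set_encode (g ` M) = set_encode (g ` M')" by (simp add: eq)
    then have "g ` M = g ` M'"
      using M finite_subset[OF _ assms] by (subst (asm) set_encode_eq) auto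
    then show "M = M'" using inj_on_image_eq_iff[OF g] M by auto
  qed
  then show ?thesis using that unfolding generic_cost_def by blast
qed

lemma cheap_imp_degree_determined:
  assumes "cheap c E F" "F \<subseteq> E"
  shows "degree_determined F"
  unfolding degree_determined_def
proof (intro allI impI)
  fix M M' assume M: "M \<subseteq> F" "M' \<subseteq> F" "same_degrees M M'"
  show "M = M'"
  proof (rule ccontr)
    assume ne: "M \<noteq> M'"
    have "M' \<subseteq> E" "M \<subseteq> E" using M assms by auto
    then have "sum c M < sum c M'" "sum c M' < sum c M"
      using assms(1) M ne same_degrees_sym[OF M(3)] unfolding cheap_def by blast+
    then show False by simp
  qed
qed

lemma degree_determined_subset: "degree_determined F \<Longrightarrow> F' \<subseteq> F \<Longrightarrow> degree_determined F'"
  unfolding degree_determined_def by auto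

lemma card_eq_sum_degrees:
  assumes "finite X" "finite Y" "F \<subseteq> X \<times> Y"
  shows "card F = (\<Sum>a\<in>X. card (F `` {a}))"
proof -
  have "F = Sigma X (\<lambda>a. F `` {a})" using assms(3) by auto
  moreover have "finite (F `` {a})" for a
    using assms by (intro finite_subset[of "F `` {a}" Y]) auto
  ultimately show ?thesis using assms(1) by (metis card_SigmaI)
qed

text \<open>
  The supplies are \<open>\<beta>\<close> scaled by \<open>card X\<close> and then raised by one. The perturbation makes every
  plan nondegenerate: no proper part of the graph can be balanced, so supports without
  cycles are spanning trees.
\<close>

definition transport_plans ::
  "'a set \<Rightarrow> 'b set \<Rightarrow> ('a \<times> 'b) set \<Rightarrow> ('a \<Rightarrow> nat) \<Rightarrow> ('a \<Rightarrow> 'b \<Rightarrow> nat) set" where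
  "transport_plans X Y E \<beta> = {f. (\<forall>a b. (a, b) \<notin> E \<longrightarrow> f a b = 0) \<and>
     (\<forall>a\<in>X. (\<Sum>b\<in>Y. f a b) = card X * \<beta> a + 1) \<and> (\<forall>b\<in>Y. (\<Sum>a\<in>X. f a b) = card X)}"

lemma transport_plans_zero: "f \<in> transport_plans X Y E \<beta> \<Longrightarrow> (a, b) \<notin> E \<Longrightarrow> f a b = 0"
  by (simp add: transport_plans_def)

lemma transport_plans_mono: "F \<subseteq> E \<Longrightarrow> transport_plans X Y F \<beta> \<subseteq> transport_plans X Y E \<beta>"
  unfolding transport_plans_def by blast

lemma plan_support_subset:
  assumes "f \<in> transport_plans X Y E \<beta>"
  shows "{(a, b). f a b > 0} \<subseteq> E"
proof clarify
  fix a b assume "f a b > 0"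
  moreover have "f a b = 0" if "(a, b) \<notin> E" using assms that by (simp add: transport_plans_def)
  ultimately show "(a, b) \<in> E" by auto
qed

lemma transport_plan_exists:
  assumes fin: "finite X" "finite Y" and E: "E \<subseteq> X \<times> Y" and \<beta>: "\<beta> \<in> hypertrees X Y E"
  shows "transport_plans X Y E \<beta> \<noteq> {}"
proof -
  have "(\<Sum>a\<in>J. card X * \<beta> a + 1) \<le> (\<Sum>b\<in>E `` J. card X)" if J: "J \<subseteq> X" for J
  proof (cases "J = {}")
    case False
    then have "sum \<beta> J + 1 \<le> card (E `` J)" using \<beta> J False by (simp add: hypertrees_def Suc_le_eq)
    then have "card X * (sum \<beta> J + 1) \<le> card X * card (E `` J)" by (rule mult_le_mono2)
    moreover have "card J \<le> card X" using J fin by (intro card_mono)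
    moreover have "(\<Sum>a\<in>J. card X * \<beta> a + 1) = card X * sum \<beta> J + card J"
      unfolding sum.distrib by (simp add: sum_distrib_left)
    ultimately show ?thesis by (simp add: algebra_simps)
  qed simp
  then obtain f where f: "\<forall>a b. (a, b) \<notin> E \<longrightarrow> f a b = 0"
    "\<forall>a\<in>X. (\<Sum>b\<in>Y. f a b) = card X * \<beta> a + 1" "\<forall>b\<in>Y. (\<Sum>a\<in>X. f a b) \<le> card X"
    using integral_transport[OF fin E, of "\<lambda>a. card X * \<beta> a + 1" "\<lambda>_. card X"] by blast
  have "(\<Sum>b\<in>Y. \<Sum>a\<in>X. f a b) = (\<Sum>a\<in>X. card X * \<beta> a + 1)"
    using f(2) by (subst sum.swap) simp
  also have "\<dots> = card X * (sum \<beta> X + 1)"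
    unfolding sum.distrib by (simp add: sum_distrib_left)
  also have "\<dots> = card X * card Y" using \<beta> by (simp add: hypertrees_def)
  finally have total: "(\<Sum>b\<in>Y. \<Sum>a\<in>X. f a b) = (\<Sum>b\<in>Y. card X)" by simp
  have "(\<Sum>a\<in>X. f a b) = card X" if "b \<in> Y" for b
  proof (rule ccontr)
    assume "\<not> ?thesis"
    then have "(\<Sum>b\<in>Y. \<Sum>a\<in>X. f a b) < (\<Sum>b\<in>Y. card X)"
      using f(3) that fin by (intro sum_strict_mono_ex1) (auto simp: order.strict_iff_order)
    then show False using total by simp
  qed
  then have "f \<in> transport_plans X Y E \<beta>" using f by (simp add: transport_plans_def)
  then show ?thesis by blast
qed

lemma card_Image_eq_sum:
  assumes "finite Y" "M \<subseteq> X \<times> Y"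
  shows "card (M `` {a}) = (\<Sum>b\<in>Y. of_bool ((a, b) \<in> M))"
proof -
  have "M `` {a} = {b\<in>Y. (a, b) \<in> M}" using assms by auto
  then show ?thesis using assms by (simp add: sum.If_cases Int_def)
qed

lemma sum_double_indicator:
  fixes c :: "'a \<times> 'b \<Rightarrow> nat"
  assumes "finite X" "finite Y" "M \<subseteq> X \<times> Y"
  shows "(\<Sum>a\<in>X. \<Sum>b\<in>Y. of_bool ((a, b) \<in> M) * c (a, b)) = sum c M"
proof -
  have "(\<Sum>a\<in>X. \<Sum>b\<in>Y. of_bool ((a, b) \<in> M) * c (a, b)) = (\<Sum>e\<in>X \<times> Y. of_bool (e \<in> M) * c e)"
    by (simp add: sum.cartesian_product split_def)
  also have "\<dots> = (\<Sum>e\<in>M. c e)"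
    using assms by (intro sum.mono_neutral_cong_right) auto
  finally show ?thesis .
qed

text \<open>
  If a set \<open>M\<close> in the support could be replaced by a set \<open>M'\<close> with the same degrees that is not more
  expensive, then rerouting one unit from \<open>M\<close> to \<open>M'\<close> would contradict optimality or
  genericity.
\<close>

lemma optimal_plan_support_cheap:
  assumes fin: "finite X" "finite Y" and E: "E \<subseteq> X \<times> Y" and c: "generic_cost E c"
    and f: "f \<in> transport_plans X Y E \<beta>"
    and opt: "\<And>g. g \<in> transport_plans X Y E \<beta> \<Longrightarrow>
      (\<Sum>a\<in>X. \<Sum>b\<in>Y. f a b * c (a, b)) \<le> (\<Sum>a\<in>X. \<Sum>b\<in>Y. g a b * c (a, b))"
  shows "cheap c E {(a, b). f a b > 0}"
  unfolding cheap_def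
proof (intro allI impI, elim conjE)
  fix M M' assume M: "M \<subseteq> {(a, b). f a b > 0}" "M' \<subseteq> E" "same_degrees M M'" "M \<noteq> M'"
  have ME: "M \<subseteq> E" using M(1) plan_support_subset[OF f] by blast
  define g where "g a b = f a b - of_bool ((a, b) \<in> M) + of_bool ((a, b) \<in> M')" for a b
  have shift: "g a b + of_bool ((a, b) \<in> M) = f a b + of_bool ((a, b) \<in> M')" for a b
    using M(1) by (auto simp: g_def)
  have MXY: "M \<subseteq> X \<times> Y" "M' \<subseteq> X \<times> Y" using ME M E by auto
  then have MYX: "M\<inverse> \<subseteq> Y \<times> X" "M'\<inverse> \<subseteq> Y \<times> X" by auto
  have row: "(\<Sum>b\<in>Y. g a b) = (\<Sum>b\<in>Y. f a b)" for a
  proof -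
    have "(\<Sum>b\<in>Y. g a b) + card (M `` {a}) = (\<Sum>b\<in>Y. f a b) + card (M' `` {a})"
      unfolding card_Image_eq_sum[OF fin(2) MXY(1)] card_Image_eq_sum[OF fin(2) MXY(2)]
      unfolding sum.distrib[symmetric] shift ..
    then show ?thesis using M(3) by (simp add: same_degrees_def)
  qed
  have col: "(\<Sum>a\<in>X. g a b) = (\<Sum>a\<in>X. f a b)" for b
  proof -
    have "(\<Sum>a\<in>X. g a b) + card (M\<inverse> `` {b}) = (\<Sum>a\<in>X. f a b) + card (M'\<inverse> `` {b})"
      unfolding card_Image_eq_sum[OF fin(1) MYX(1)] card_Image_eq_sum[OF fin(1) MYX(2)]
      unfolding sum.distrib[symmetric] converse_iff shift ..
    then show ?thesis using M(3) by (simp add: same_degrees_def)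
  qed
  have "g \<in> transport_plans X Y E \<beta>"
    using f row col ME M(2) by (auto simp: transport_plans_def g_def)
  moreover have "(\<Sum>a\<in>X. \<Sum>b\<in>Y. g a b * c (a, b)) + sum c M =
      (\<Sum>a\<in>X. \<Sum>b\<in>Y. f a b * c (a, b)) + sum c M'"
    unfolding sum_double_indicator[OF fin MXY(1), symmetric]
      sum_double_indicator[OF fin MXY(2), symmetric] sum.distrib[symmetric]
      distrib_right[symmetric] shift ..
  ultimately have "sum c M \<le> sum c M'" using opt[of g] by linarith
  moreover have "sum c M \<noteq> sum c M'"
    using c ME M(2,4) unfolding generic_cost_def by (auto dest: inj_onD)
  ultimately show "sum c M < sum c M'" by simp
qed

text \<open>
  An edge carries at most \<open>card X\<close> units, so a vertex with supply \<open>card X * \<beta> a + 1\<close> needs at least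
  \<open>\<beta> a + 1\<close> edges. These lower bounds add up to \<open>card X + card Y - 1\<close>, the maximal number of edges of a
  forest, so all of them are equalities.
\<close>

lemma plan_support_is_tree:
  assumes fin: "finite X" "finite Y" and ne: "X \<noteq> {}" "Y \<noteq> {}" and E: "E \<subseteq> X \<times> Y"
    and \<beta>: "\<beta> \<in> hypertrees X Y E" and f: "f \<in> transport_plans X Y E \<beta>"
    and F: "F = {(a, b). f a b > 0}" and det: "degree_determined F"
  shows "F \<subseteq> E" "card F + 1 = card X + card Y" "\<And>a. a \<in> X \<Longrightarrow> card (F `` {a}) = \<beta> a + 1"
    "\<And>b. b \<in> Y \<Longrightarrow> F\<inverse> `` {b} \<noteq> {}"
proof -
  show FE: "F \<subseteq> E" unfolding F by (rule plan_support_subset[OF f])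
  then have FXY: "F \<subseteq> X \<times> Y" using E by auto
  have upper: "card F < card X + card Y" using forest_bound[OF fin ne FXY det] .
  have K: "card X > 0" using fin ne by (simp add: card_gt_0_iff)
  show "F\<inverse> `` {b} \<noteq> {}" if "b \<in> Y" for b
  proof -
    have "(\<Sum>a\<in>X. f a b) > 0" using f that K by (simp add: transport_plans_def)
    then have "\<not> (\<forall>a\<in>X. f a b = 0)" by (metis less_irrefl sum.neutral)
    then obtain a where "a \<in> X" "f a b > 0" by auto
    then show ?thesis by (auto simp: F)
  qed
  have bound: "f a b \<le> card X" if "a \<in> X" "b \<in> Y" for a b
  proof -
    have "f a b \<le> (\<Sum>a\<in>X. f a b)" using fin that by (intro member_le_sum) auto
    then show ?thesis using f that by (simp add: transport_plans_def)
  qed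
  have lower: "\<beta> a + 1 \<le> card (F `` {a})" if a: "a \<in> X" for a
  proof -
    have "card X * \<beta> a + 1 = (\<Sum>b\<in>Y. f a b)" using f a by (simp add: transport_plans_def)
    also have "\<dots> = (\<Sum>b\<in>F `` {a}. f a b)"
      using fin FXY by (intro sum.mono_neutral_right) (auto simp: F)
    also have "\<dots> \<le> (\<Sum>b\<in>F `` {a}. card X)"
      using bound a FXY by (intro sum_mono) auto
    finally have "card X * \<beta> a < card X * card (F `` {a})"
      by (simp add: mult.commute Suc_le_eq)
    then have "\<beta> a < card (F `` {a})" by (metis mult_less_cancel1)
    then show ?thesis by simp
  qed
  have "(\<Sum>a\<in>X. \<beta> a + 1) = sum \<beta> X + card X" unfolding sum.distrib by simp
  also have "\<dots> + 1 = card X + card Y" using \<beta> by (simp add: hypertrees_def)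
  finally have total: "(\<Sum>a\<in>X. \<beta> a + 1) + 1 = card X + card Y" .
  have cF: "card F = (\<Sum>a\<in>X. card (F `` {a}))" using card_eq_sum_degrees[OF fin FXY] .
  moreover have "(\<Sum>a\<in>X. \<beta> a + 1) \<le> (\<Sum>a\<in>X. card (F `` {a}))"
    using lower by (rule sum_mono)
  ultimately show "card F + 1 = card X + card Y" using upper total by linarith
  then have eq: "(\<Sum>a\<in>X. card (F `` {a})) = (\<Sum>a\<in>X. \<beta> a + 1)" using total cF by linarith
  show "card (F `` {a}) = \<beta> a + 1" if a: "a \<in> X" for a
  proof (rule ccontr)
    assume "\<not> ?thesis"
    then have "\<beta> a + 1 < card (F `` {a})" using lower[OF a] by linarith
    then have "(\<Sum>a\<in>X. \<beta> a + 1) < (\<Sum>a\<in>X. card (F `` {a}))"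
      using lower a fin by (intro sum_strict_mono_ex1) blast+
    then show False using eq by simp
  qed
qed

lemma optimal_plan:
  assumes fin: "finite X" "finite Y" and ne: "X \<noteq> {}" "Y \<noteq> {}" and E: "E \<subseteq> X \<times> Y"
    and c: "generic_cost E c" and \<beta>: "\<beta> \<in> hypertrees X Y E"
  shows "\<exists>f F. f \<in> transport_plans X Y E \<beta> \<and> F = {(a, b). f a b > 0} \<and>
    F \<in> cheap_trees c X Y E \<and> (\<forall>a\<in>X. card (F `` {a}) = \<beta> a + 1)"
proof -
  define cost where "cost f = (\<Sum>a\<in>X. \<Sum>b\<in>Y. f a b * c (a, b))" for f
  obtain f where f: "f \<in> transport_plans X Y E \<beta>"
    "\<And>g. g \<in> transport_plans X Y E \<beta> \<Longrightarrow> cost f \<le> cost g"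
    using transport_plan_exists[OF fin E \<beta>]
      ex_has_least_nat[of "\<lambda>f. f \<in> transport_plans X Y E \<beta>" _ cost] by blast
  define F where "F = {(a, b). f a b > 0}"
  have cheap: "cheap c E F"
    unfolding F_def by (rule optimal_plan_support_cheap[OF fin E c f[unfolded cost_def]])
  have FE: "F \<subseteq> E" unfolding F_def by (rule plan_support_subset[OF f(1)])
  note tree = plan_support_is_tree[OF fin ne E \<beta> f(1) F_def cheap_imp_degree_determined[OF cheap FE]]
  have "F `` {a} \<noteq> {}" if "a \<in> X" for a
    using tree(3)[OF that] by (metis add_is_0 card.empty one_neq_zero)
  then have "F \<in> cheap_trees c X Y E"
    using tree cheap by (auto simp: cheap_trees_def)
  then show ?thesis using f(1) F_def tree(3) by blast
qed

text \<open>
  The inequality for \<open>J\<close> is \<open>forest_bound\<close> for the part of \<open>F\<close> between \<open>J\<close> and its neighbours.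
\<close>

lemma tree_degrees_hypertree:
  assumes fin: "finite X" "finite Y" and ne: "X \<noteq> {}" "Y \<noteq> {}"
    and FXY: "F \<subseteq> X \<times> Y" and det: "degree_determined F"
    and size: "card F + 1 = card X + card Y" and deg: "\<forall>a\<in>X. F `` {a} \<noteq> {}"
  shows "restrict (\<lambda>a. card (F `` {a}) - 1) X \<in> hypertrees X Y F"
proof -
  let ?\<beta> = "restrict (\<lambda>a. card (F `` {a}) - 1) X"
  have finF: "finite (F `` J)" for J
    using FXY fin by (intro finite_subset[of "F `` J" Y]) auto
  have sum_\<beta>: "sum ?\<beta> J + card J = (\<Sum>a\<in>J. card (F `` {a}))" if "J \<subseteq> X" for J
  proof -
    have pos: "card (F `` {a}) \<ge> 1" if "a \<in> J" for a
      using deg that \<open>J \<subseteq> X\<close> finF[of "{a}"] by (simp add: Suc_le_eq card_gt_0_iff subset_eq)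
    have "sum ?\<beta> J + card J = (\<Sum>a\<in>J. ?\<beta> a + 1)" unfolding sum.distrib by simp
    also have "\<dots> = (\<Sum>a\<in>J. card (F `` {a}))"
    proof (rule sum.cong[OF refl])
      fix a assume a: "a \<in> J"
      then have "a \<in> X" using that by auto
      then show "?\<beta> a + 1 = card (F `` {a})" using pos[OF a] by simp
    qed
    finally show ?thesis .
  qed
  have "sum ?\<beta> J < card (F `` J)" if J: "J \<subseteq> X" "J \<noteq> {}" for J
  proof -
    define F' where "F' = F \<inter> (J \<times> UNIV)"
    have finJ: "finite J" using J fin finite_subset by auto
    have F': "F' \<subseteq> J \<times> F `` J" by (auto simp: F'_def)
    obtain a where "a \<in> J" using J by auto
    then have "F `` {a} \<noteq> {}" "F `` {a} \<subseteq> F `` J" using deg J by auto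
    then have "F `` J \<noteq> {}" by blast
    then have "card F' < card J + card (F `` J)"
      using F' J finJ finF degree_determined_subset[OF det, of F']
      by (intro forest_bound) (auto simp: F'_def)
    moreover have "card F' = (\<Sum>a\<in>J. card (F' `` {a}))"
      using card_eq_sum_degrees[OF finJ finF F'] .
    moreover have "(\<Sum>a\<in>J. card (F' `` {a})) = (\<Sum>a\<in>J. card (F `` {a}))"
    proof (rule sum.cong[OF refl])
      fix a assume "a \<in> J"
      then have "F' `` {a} = F `` {a}" by (auto simp: F'_def)
      then show "card (F' `` {a}) = card (F `` {a})" by simp
    qed
    ultimately show ?thesis using sum_\<beta>[OF J(1)] by linarith
  qed
  moreover have "sum ?\<beta> X + 1 = card Y"
    using sum_\<beta>[of X] card_eq_sum_degrees[OF fin FXY] size by simp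
  ultimately show ?thesis by (simp add: hypertrees_def)
qed

lemma hypertrees_mono:
  assumes "E \<subseteq> E'" "E' \<subseteq> X \<times> Y" "finite Y"
  shows "hypertrees X Y E \<subseteq> hypertrees X Y E'"
proof
  fix \<beta> assume \<beta>: "\<beta> \<in> hypertrees X Y E"
  have "card (E `` J) \<le> card (E' `` J)" for J
  proof (rule card_mono)
    show "finite (E' `` J)" using assms by (intro finite_subset[of "E' `` J" Y]) auto
  qed (use assms in auto)
  then show "\<beta> \<in> hypertrees X Y E'"
    using \<beta> unfolding hypertrees_def mem_Collect_eq by (meson less_le_trans)
qed

text \<open>
  A plan within the graph \<open>F\<close> itself is supported on a spanning tree contained in \<open>F\<close>,
  and two spanning trees of which one contains the other are equal.
\<close>

lemma tree_supports_plan: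
  assumes fin: "finite X" "finite Y" and ne: "X \<noteq> {}" "Y \<noteq> {}" and E: "E \<subseteq> X \<times> Y"
    and c: "generic_cost E c" and F: "F \<in> cheap_trees c X Y E"
    and \<beta>: "\<beta> = restrict (\<lambda>a. card (F `` {a}) - 1) X"
  obtains f where "f \<in> transport_plans X Y F \<beta>" "F = {(a, b). f a b > 0}"
proof -
  have F': "F \<subseteq> E" "cheap c E F" "card F + 1 = card X + card Y" "\<forall>a\<in>X. F `` {a} \<noteq> {}"
    using F by (auto simp: cheap_trees_def)
  then have FXY: "F \<subseteq> X \<times> Y" using E by auto
  have hyper: "\<beta> \<in> hypertrees X Y F"
    unfolding \<beta> using tree_degrees_hypertree[OF fin ne FXY _ F'(3,4)]
      cheap_imp_degree_determined[OF F'(2,1)] by blast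
  have gen: "generic_cost F c"
    using c F'(1) unfolding generic_cost_def by (meson Pow_mono inj_on_subset)
  obtain f G where f: "f \<in> transport_plans X Y F \<beta>" "G = {(a, b). f a b > 0}"
    "G \<in> cheap_trees c X Y F"
    using optimal_plan[OF fin ne FXY gen hyper] by blast
  have "finite F" using FXY fin by (meson finite_SigmaI finite_subset)
  then have "G = F"
    using f(3) F'(3) by (intro card_subset_eq) (auto simp: cheap_trees_def)
  then show ?thesis using that f by blast
qed

text \<open>
  The difference of two plans is a circulation. A signed cycle in it consists of sets
  \<open>M\<close> and \<open>M'\<close> in the two supports with equal degrees, each of which would be strictly cheaper than
  the other.
\<close>

lemma cheap_plan_unique:
  assumes fin: "finite X" "finite Y" and E: "E \<subseteq> X \<times> Y"
    and f: "f \<in> transport_plans X Y E \<beta>" "cheap c E {(a, b). f a b > 0}"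
    and g: "g \<in> transport_plans X Y E \<beta>" "cheap c E {(a, b). g a b > 0}"
  shows "f = g"
proof (rule ccontr)
  assume "f \<noteq> g"
  then obtain a0 b0 where ab: "f a0 b0 \<noteq> g a0 b0" by blast
  define d where "d a b = real (f a b) - real (g a b)" for a b
  have "(a0, b0) \<in> E"
    using ab transport_plans_zero[OF f(1), of a0 b0] transport_plans_zero[OF g(1), of a0 b0]
    by (cases "(a0, b0) \<in> E") auto
  then have nz: "a0 \<in> X" "b0 \<in> Y" "d a0 b0 \<noteq> 0" using E ab by (auto simp: d_def)
  have row: "(\<Sum>b\<in>Y. d a b) = 0" if "a \<in> X" for a
    using f g that by (simp add: d_def sum_subtractf transport_plans_def flip: of_nat_sum)
  have col: "(\<Sum>a\<in>X. d a b) = 0" if "b \<in> Y" for b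
    using f g that by (simp add: d_def sum_subtractf transport_plans_def flip: of_nat_sum)
  obtain M M' where M: "M \<noteq> {}" "M \<subseteq> {(a, b). a \<in> X \<and> b \<in> Y \<and> d a b > 0}"
    "M' \<subseteq> {(a, b). a \<in> X \<and> b \<in> Y \<and> d a b < 0}" "same_degrees M M'"
    by (rule circulation_contains_signed_cycle[OF fin row col nz])
  have sub: "M \<subseteq> {(a, b). f a b > 0}" "M' \<subseteq> {(a, b). g a b > 0}"
    using M(2,3) by (auto simp: d_def)
  moreover have "{(a, b). f a b > 0} \<subseteq> E" "{(a, b). g a b > 0} \<subseteq> E"
    using plan_support_subset f(1) g(1) by blast+
  ultimately have ME: "M \<subseteq> E" "M' \<subseteq> E" by auto
  have "M \<noteq> M'" using M(1-3) by force
  then have "sum c M < sum c M'" "sum c M' < sum c M"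
    using f(2) g(2) sub ME M(4) same_degrees_sym[OF M(4)] unfolding cheap_def by metis+
  then show False by simp
qed

text \<open>
  Taking degrees minus one is injective on cheap trees because a tree is the support of the
  unique cheap plan for its own degrees, and surjective because a cheapest plan exists.
\<close>

lemma card_hypertrees_eq_card_cheap_trees:
  assumes fin: "finite X" "finite Y" and ne: "X \<noteq> {}" "Y \<noteq> {}" and E: "E \<subseteq> X \<times> Y"
    and c: "generic_cost E c"
  shows "card (hypertrees X Y E) = card (cheap_trees c X Y E)"
proof -
  define \<Phi> where "\<Phi> F = restrict (\<lambda>a. card (F `` {a}) - 1) X" for F :: "('a \<times> 'b) set"
  have "inj_on \<Phi> (cheap_trees c X Y E)"
  proof (rule inj_onI)
    fix F G assume F: "F \<in> cheap_trees c X Y E" and G: "G \<in> cheap_trees c X Y E"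
      and eq: "\<Phi> F = \<Phi> G"
    obtain f where f: "f \<in> transport_plans X Y F (\<Phi> F)" "F = {(a, b). f a b > 0}"
      by (rule tree_supports_plan[OF fin ne E c F \<Phi>_def])
    obtain g where g: "g \<in> transport_plans X Y G (\<Phi> G)" "G = {(a, b). g a b > 0}"
      by (rule tree_supports_plan[OF fin ne E c G \<Phi>_def])
    have fE: "f \<in> transport_plans X Y E (\<Phi> F)" and gE: "g \<in> transport_plans X Y E (\<Phi> F)"
      using f(1) g(1) F G eq transport_plans_mono[of F E X Y "\<Phi> F"]
        transport_plans_mono[of G E X Y "\<Phi> F"] by (auto simp: cheap_trees_def)
    have "cheap c E {(a, b). f a b > 0}" "cheap c E {(a, b). g a b > 0}"
      using F G f(2) g(2) by (auto simp: cheap_trees_def)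
    then have "f = g" using cheap_plan_unique[OF fin E fE _ gE] by blast
    then show "F = G" using f g by simp
  qed
  moreover have "\<Phi> ` cheap_trees c X Y E = hypertrees X Y E"
  proof (intro equalityI subsetI)
    fix \<beta> assume "\<beta> \<in> \<Phi> ` cheap_trees c X Y E"
    then obtain F where F: "F \<in> cheap_trees c X Y E" "\<beta> = \<Phi> F" by auto
    have "F \<subseteq> E" "F \<subseteq> X \<times> Y" using F E by (auto simp: cheap_trees_def)
    moreover have "\<beta> \<in> hypertrees X Y F"
      unfolding F(2) \<Phi>_def using F(1) \<open>F \<subseteq> X \<times> Y\<close>
      by (intro tree_degrees_hypertree[OF fin ne])
         (auto simp: cheap_trees_def intro: cheap_imp_degree_determined)
    ultimately show "\<beta> \<in> hypertrees X Y E" using hypertrees_mono[OF _ E fin(2)] by blast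
  next
    fix \<beta> assume \<beta>: "\<beta> \<in> hypertrees X Y E"
    obtain F where F: "F \<in> cheap_trees c X Y E" "\<forall>a\<in>X. card (F `` {a}) = \<beta> a + 1"
      using optimal_plan[OF fin ne E c \<beta>] by blast
    have "\<beta> = \<Phi> F"
      using \<beta> F(2) by (auto simp: \<Phi>_def hypertrees_def PiE_iff extensional_def fun_eq_iff)
    then show "\<beta> \<in> \<Phi> ` cheap_trees c X Y E" using F(1) by blast
  qed
  ultimately show ?thesis by (metis card_image)
qed

lemma sum_converse: "sum c (M\<inverse>) = sum (\<lambda>(a, b). c (b, a)) M"
  by (rule sum.reindex_bij_witness[of _ prod.swap prod.swap]) auto

theorem card_hypertrees_converse:
  assumes fin: "finite X" "finite Y" and ne: "X \<noteq> {}" "Y \<noteq> {}" and E: "E \<subseteq> X \<times> Y"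
  shows "card (hypertrees X Y E) = card (hypertrees Y X (E\<inverse>))"
proof -
  have "finite E" using E fin by (meson finite_SigmaI finite_subset)
  then obtain c where c: "generic_cost E c" using ex_generic_cost by blast
  define c' where "c' = (\<lambda>(b, a). c (a, b))"
  have c'_sum: "sum c' M = sum c (M\<inverse>)" for M
    by (simp add: c'_def sum_converse)
  have c': "generic_cost (E\<inverse>) c'"
    unfolding generic_cost_def
  proof (rule inj_onI)
    fix M M' assume "M \<in> Pow (E\<inverse>)" "M' \<in> Pow (E\<inverse>)" "sum c' M = sum c' M'"
    then have "M\<inverse> \<in> Pow E" "M'\<inverse> \<in> Pow E" "sum c (M\<inverse>) = sum c (M'\<inverse>)"
      by (auto simp: c'_sum)
    then have "M\<inverse> = M'\<inverse>" using c unfolding generic_cost_def by (metis inj_onD)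
    then show "M = M'" by (metis converse_converse)
  qed
  have "cheap c' (E\<inverse>) (F\<inverse>) \<longleftrightarrow> cheap c E F" for F
  proof -
    have all: "(\<forall>M\<subseteq>G\<inverse>. P M) \<longleftrightarrow> (\<forall>M\<subseteq>G. P (M\<inverse>))" for P and G :: "('a \<times> 'b) set"
      by (metis converse_converse converse_mono)
    show ?thesis
      unfolding cheap_def all by (simp add: c'_sum same_degrees_converse)
  qed
  then have iff: "F\<inverse> \<in> cheap_trees c' Y X (E\<inverse>) \<longleftrightarrow> F \<in> cheap_trees c X Y E" for F
    by (auto simp: cheap_trees_def)
  have "bij_betw converse (cheap_trees c X Y E) (cheap_trees c' Y X (E\<inverse>))"
  proof (rule bij_betw_byWitness[where f' = converse])
    show "converse ` cheap_trees c' Y X (E\<inverse>) \<subseteq> cheap_trees c X Y E"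
      using iff[of "_\<inverse>"] by auto
  qed (use iff in auto)
  then have "card (cheap_trees c X Y E) = card (cheap_trees c' Y X (E\<inverse>))"
    by (rule bij_betw_same_card)
  moreover have "E\<inverse> \<subseteq> Y \<times> X" using E by auto
  ultimately show ?thesis
    using card_hypertrees_eq_card_cheap_trees[OF fin ne E c]
      card_hypertrees_eq_card_cheap_trees[OF fin(2,1) ne(2,1) _ c'] by simp
qed

section \<open>Duality for degree vectors\<close>

text \<open>
  By Hall's theorem these are the degrees at \<open>I\<close> of the sets of edges that use every vertex on the
  other side at most once.
\<close>

definition degree_vectors :: "'a set \<Rightarrow> ('a \<times> 'b) set \<Rightarrow> ('a \<Rightarrow> nat) set" where
  "degree_vectors I E = {\<beta> \<in> I \<rightarrow>\<^sub>E UNIV. \<forall>J\<subseteq>I. sum \<beta> J \<le> card (E `` J)}"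

text \<open>
  Adding one vertex on each side, adjacent to everything on the other side, turns the inequalities
  for degree vectors into those for hypertrees. The new coordinate takes up the slack in
  the total sum.
\<close>

definition cone_graph :: "'a set \<Rightarrow> 'b set \<Rightarrow> ('a \<times> 'b) set \<Rightarrow> ('a option \<times> 'b option) set" where
  "cone_graph I V E = map_prod Some Some ` E \<union> {None} \<times> insert None (Some ` V) \<union>
     insert None (Some ` I) \<times> {None}"

lemma converse_cone_graph: "(cone_graph I V E)\<inverse> = cone_graph V I (E\<inverse>)"
  by (force simp: cone_graph_def)

lemma card_hypertrees_cone_graph:
  assumes fin: "finite I" "finite V" and E: "E \<subseteq> I \<times> V"
  shows "card (hypertrees (insert None (Some ` I)) (insert None (Some ` V)) (cone_graph I V E)) =
    card (degree_vectors I E)"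
proof -
  define X where "X = insert None (Some ` I)"
  define Y where "Y = insert None (Some ` V)"
  have cardY: "card Y = card V + 1" using fin by (simp add: Y_def card_image)
  have finX: "finite X" using fin by (simp add: X_def)
  have sumX: "sum \<beta> X = \<beta> None + (\<Sum>i\<in>I. \<beta> (Some i))" for \<beta> :: "'a option \<Rightarrow> nat"
    using fin by (simp add: X_def sum.reindex)
  have finE: "finite (E `` J)" for J
    using E by (intro finite_subset[OF _ fin(2)]) blast
  have nbrs: "card (cone_graph I V E `` (Some ` J)) = card (E `` J) + 1" if J: "J \<subseteq> I" "J \<noteq> {}" for J
  proof -
    have "cone_graph I V E `` (Some ` J) = insert None (Some ` (E `` J))"
    proof (rule equalityI)
      show "cone_graph I V E `` (Some ` J) \<subseteq> insert None (Some ` (E `` J))" by (auto simp: cone_graph_def)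
      obtain j where "j \<in> J" using J by auto
      then have "(Some j, None) \<in> cone_graph I V E" using J by (auto simp: cone_graph_def)
      moreover have "(Some a, Some b) \<in> cone_graph I V E" if "(a, b) \<in> E" for a b
        using that by (auto simp: cone_graph_def)
      ultimately show "insert None (Some ` (E `` J)) \<subseteq> cone_graph I V E `` (Some ` J)"
        using \<open>j \<in> J\<close> by blast
    qed
    then show ?thesis using finE by (simp add: card_image)
  qed
  have nbrs_None: "cone_graph I V E `` K = Y" if "K \<subseteq> X" "None \<in> K" for K
  proof -
    have "cone_graph I V E \<subseteq> X \<times> Y" using E by (auto simp: cone_graph_def X_def Y_def)
    moreover have "{None} \<times> Y \<subseteq> cone_graph I V E" by (auto simp: cone_graph_def Y_def)
    ultimately show ?thesis using that by blast
  qed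
  define \<Phi> where "\<Phi> \<beta> = restrict (\<beta> \<circ> Some) I" for \<beta> :: "'a option \<Rightarrow> nat"
  define \<Psi> where "\<Psi> \<beta> x = (case x of None \<Rightarrow> card V - sum \<beta> I | Some i \<Rightarrow> \<beta> i)"
    for \<beta> :: "'a \<Rightarrow> nat" and x
  have "bij_betw \<Phi> (hypertrees X Y (cone_graph I V E)) (degree_vectors I E)"
  proof (rule bij_betw_byWitness[where f' = \<Psi>])
    show "\<forall>\<beta>\<in>hypertrees X Y (cone_graph I V E). \<Psi> (\<Phi> \<beta>) = \<beta>"
    proof
      fix \<beta> assume \<beta>: "\<beta> \<in> hypertrees X Y (cone_graph I V E)"
      then have tot: "\<beta> None + (\<Sum>i\<in>I. \<beta> (Some i)) = card V"
        using cardY by (simp add: hypertrees_def sumX)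
      have "\<beta> \<in> extensional X" using \<beta> by (auto simp: hypertrees_def PiE_def)
      then have "\<beta> (Some i) = undefined" if "i \<notin> I" for i
        using that by (auto simp: X_def extensional_def)
      then show "\<Psi> (\<Phi> \<beta>) = \<beta>"
        using tot by (auto simp: \<Psi>_def \<Phi>_def fun_eq_iff split: option.splits)
    qed
    show "\<forall>\<beta>\<in>degree_vectors I E. \<Phi> (\<Psi> \<beta>) = \<beta>"
      by (auto simp: degree_vectors_def \<Phi>_def \<Psi>_def fun_eq_iff PiE_def extensional_def)
    show "\<Phi> ` hypertrees X Y (cone_graph I V E) \<subseteq> degree_vectors I E"
    proof clarify
      fix \<beta> assume \<beta>: "\<beta> \<in> hypertrees X Y (cone_graph I V E)"
      have "sum (\<Phi> \<beta>) J \<le> card (E `` J)" if J: "J \<subseteq> I" for J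
      proof (cases "J = {}")
        case False
        have sub: "Some ` J \<subseteq> X" "Some ` J \<noteq> {}" using J False by (auto simp: X_def)
        have "sum (\<Phi> \<beta>) J = sum \<beta> (Some ` J)"
          using J by (auto simp: \<Phi>_def sum.reindex intro!: sum.cong)
        also have "\<dots> < card (cone_graph I V E `` (Some ` J))"
          using \<beta> sub unfolding hypertrees_def by blast
        finally show ?thesis using nbrs[OF J False] by simp
      qed simp
      then show "\<Phi> \<beta> \<in> degree_vectors I E" by (simp add: degree_vectors_def \<Phi>_def)
    qed
    show "\<Psi> ` degree_vectors I E \<subseteq> hypertrees X Y (cone_graph I V E)"
    proof clarify
      fix \<beta> assume \<beta>: "\<beta> \<in> degree_vectors I E"
      have "sum \<beta> I \<le> card (E `` I)" using \<beta> by (simp add: degree_vectors_def)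
      also have "\<dots> \<le> card V" using E fin by (intro card_mono) auto
      finally have le: "sum \<beta> I \<le> card V" .
      have tot: "sum (\<Psi> \<beta>) X = card V" using le by (simp add: sumX \<Psi>_def)
      have "sum (\<Psi> \<beta>) K < card (cone_graph I V E `` K)" if K: "K \<subseteq> X" "K \<noteq> {}" for K
      proof (cases "None \<in> K")
        case True
        have "sum (\<Psi> \<beta>) K \<le> sum (\<Psi> \<beta>) X" using K finX by (intro sum_mono2) auto
        then show ?thesis using nbrs_None[OF K(1) True] tot cardY by simp
      next
        case False
        then have "K \<subseteq> Some ` I" using K by (auto simp: X_def)
        then obtain J where J: "J \<subseteq> I" "K = Some ` J" by (auto simp: subset_image_iff)
        have "sum (\<Psi> \<beta>) K = sum \<beta> J" by (simp add: J(2) sum.reindex \<Psi>_def)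
        also have "\<dots> \<le> card (E `` J)" using \<beta> J by (auto simp: degree_vectors_def)
        finally show ?thesis using nbrs[OF J(1)] J(2) K(2) by simp
      qed
      moreover have "\<Psi> \<beta> \<in> extensional X"
        using \<beta> by (auto simp: \<Psi>_def X_def extensional_def degree_vectors_def PiE_def
            split: option.splits)
      ultimately show "\<Psi> \<beta> \<in> hypertrees X Y (cone_graph I V E)"
        using tot cardY by (auto simp: hypertrees_def PiE_def)
    qed
  qed
  then show ?thesis unfolding X_def Y_def by (rule bij_betw_same_card)
qed

theorem card_degree_vectors_converse:
  assumes fin: "finite I" "finite V" and E: "E \<subseteq> I \<times> V"
  shows "card (degree_vectors I E) = card (degree_vectors V (E\<inverse>))"
proof -
  have "E\<inverse> \<subseteq> V \<times> I" using E by auto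
  moreover have "cone_graph I V E \<subseteq> insert None (Some ` I) \<times> insert None (Some ` V)"
    using E by (auto simp: cone_graph_def)
  ultimately show ?thesis
    using card_hypertrees_cone_graph[OF fin E] card_hypertrees_cone_graph[OF fin(2,1), of "E\<inverse>"]
      card_hypertrees_converse[of "insert None (Some ` I)" "insert None (Some ` V)" "cone_graph I V E"] fin
    by (simp add: converse_cone_graph)
qed

section \<open>The case of nonnegative multiplicities\<close>

lemma card_compositions:
  fixes m a :: nat
  shows "card {g \<in> {..<m} \<rightarrow>\<^sub>E UNIV. sum g {..<m} = a} = (m + a - 1) choose a"
    "finite {g \<in> {..<m} \<rightarrow>\<^sub>E (UNIV :: nat set). sum g {..<m} = a}"
proof -
  have "bij_betw (\<lambda>l. restrict ((!) l) {..<m}) {l::nat list. size l = m \<and> sum_list l = a}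
      {g \<in> {..<m} \<rightarrow>\<^sub>E UNIV. sum g {..<m} = a}"
    by (rule bij_betw_byWitness[where f' = "\<lambda>g. map g [0..<m]"])
       (auto simp: sum_list_sum_nth atLeast0LessThan list_eq_iff_nth_eq fun_eq_iff
          PiE_def extensional_def)
  then show "card {g \<in> {..<m} \<rightarrow>\<^sub>E UNIV. sum g {..<m} = a} = (m + a - 1) choose a"
    using card_length_sum_list[of m a] by (metis (no_types, lifting) add.commute bij_betw_same_card)
  have "{g \<in> {..<m} \<rightarrow>\<^sub>E (UNIV :: nat set). sum g {..<m} = a} \<subseteq> {..<m} \<rightarrow>\<^sub>E {..a}"
    by (auto simp: PiE_iff extensional_def intro!: member_le_sum)
  then show "finite {g \<in> {..<m} \<rightarrow>\<^sub>E (UNIV :: nat set). sum g {..<m} = a}"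
    by (rule finite_subset) (simp add: finite_PiE)
qed

lemma finite_nonempty_subsets: "finite (nonempty_subsets n)"
  by (simp add: nonempty_subsets_def)

definition copies :: "nat \<Rightarrow> (nat set \<Rightarrow> nat) \<Rightarrow> (nat set \<times> nat) set" where
  "copies n m = Sigma (nonempty_subsets n) (\<lambda>A. {..<m A})"

definition membership :: "nat \<Rightarrow> (nat set \<Rightarrow> nat) \<Rightarrow> ((nat set \<times> nat) \<times> nat) set" where
  "membership n m = {((A, k), v). (A, k) \<in> copies n m \<and> v \<in> A}"

lemma finite_copies: "finite (copies n m)"
  by (simp add: copies_def finite_nonempty_subsets)

lemma membership_subset: "membership n m \<subseteq> copies n m \<times> {1..n}"
  by (auto simp: membership_def copies_def nonempty_subsets_def)

definition family_sums :: "nat \<Rightarrow> (nat set \<Rightarrow> nat) \<Rightarrow> (nat set \<times> nat \<Rightarrow> nat) \<Rightarrow> nat set \<Rightarrow> nat" where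
  "family_sums n m \<beta> = restrict (\<lambda>A. \<Sum>k<m A. \<beta> (A, k)) (nonempty_subsets n)"

lemma sum_family_sums:
  assumes "E \<subseteq> nonempty_subsets n"
  shows "sum (family_sums n m \<beta>) E = sum \<beta> (Sigma E (\<lambda>A. {..<m A}))"
proof -
  have "finite E" using assms finite_nonempty_subsets finite_subset by blast
  then have "sum \<beta> (Sigma E (\<lambda>A. {..<m A})) = (\<Sum>A\<in>E. \<Sum>k<m A. \<beta> (A, k))"
    by (subst sum.Sigma) auto
  also have "\<dots> = sum (family_sums n m \<beta>) E"
    using assms by (intro sum.cong) (auto simp: family_sums_def)
  finally show ?thesis by simp
qed

text \<open>
  Replacing a set of copies by all copies of the same sets does not change its neighbourhood. So only
  the totals over the copies of each set matter, and the condition on them is the one that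
  defines \<open>D n\<close>.
\<close>

lemma degree_vectors_membership:
  "degree_vectors (copies n m) (membership n m) =
    {\<beta> \<in> copies n m \<rightarrow>\<^sub>E UNIV. family_sums n m \<beta> \<in> D n}"
proof -
  have img: "membership n m `` J = \<Union>(fst ` J)" if "J \<subseteq> copies n m" for J
    using that by (force simp: membership_def)
  have finU: "finite (\<Union>E)" if "E \<subseteq> nonempty_subsets n" for E
    using that by (intro finite_subset[of "\<Union>E" "{1..n}"]) (auto simp: nonempty_subsets_def)
  have "family_sums n m \<beta> \<in> D n" if \<beta>: "\<forall>J\<subseteq>copies n m. sum \<beta> J \<le> card (membership n m `` J)" for \<beta>
  proof -
    have "sum (family_sums n m \<beta>) E \<le> card (\<Union>E)" if E: "E \<subseteq> nonempty_subsets n" for E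
    proof -
      let ?J = "Sigma E (\<lambda>A. {..<m A})"
      have J: "?J \<subseteq> copies n m" using E by (auto simp: copies_def)
      have "sum (family_sums n m \<beta>) E \<le> card (\<Union>(fst ` ?J))"
        using \<beta> J img[OF J] unfolding sum_family_sums[OF E] by metis
      also have "\<dots> \<le> card (\<Union>E)" using finU[OF E] by (intro card_mono) auto
      finally show ?thesis .
    qed
    then show ?thesis by (simp add: D_def family_sums_def)
  qed
  moreover have "sum \<beta> J \<le> card (membership n m `` J)"
    if \<beta>: "family_sums n m \<beta> \<in> D n" and J: "J \<subseteq> copies n m" for \<beta> J
  proof (cases "J = {}")
    case False
    have E: "fst ` J \<subseteq> nonempty_subsets n" using J by (auto simp: copies_def)
    have "sum \<beta> J \<le> sum \<beta> (Sigma (fst ` J) (\<lambda>A. {..<m A}))"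
    proof (rule sum_mono2)
      have "Sigma (fst ` J) (\<lambda>A. {..<m A}) \<subseteq> copies n m" using E by (auto simp: copies_def)
      then show "finite (Sigma (fst ` J) (\<lambda>A. {..<m A}))" using finite_copies finite_subset by blast
      show "J \<subseteq> Sigma (fst ` J) (\<lambda>A. {..<m A})" using J by (force simp: copies_def)
    qed auto
    also have "\<dots> = sum (family_sums n m \<beta>) (fst ` J)" by (simp add: sum_family_sums[OF E])
    also have "\<dots> \<le> card (\<Union>(fst ` J))" using \<beta> E False by (auto simp: D_def)
    finally show ?thesis by (simp add: img[OF J])
  qed simp
  ultimately show ?thesis unfolding degree_vectors_def by blast
qed

lemma card_family_sums_fibre:
  fixes m :: "nat set \<Rightarrow> nat"
  assumes \<alpha>: "\<alpha> \<in> nonempty_subsets n \<rightarrow>\<^sub>E UNIV"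
  defines "S \<equiv> {\<beta> \<in> copies n m \<rightarrow>\<^sub>E UNIV. family_sums n m \<beta> = \<alpha>}"
  shows "card S = (\<Prod>A\<in>nonempty_subsets n. (m A + \<alpha> A - 1) choose \<alpha> A)" "finite S"
proof -
  let ?NS = "nonempty_subsets n"
  define T where "T = (PiE ?NS (\<lambda>A. {g \<in> {..<m A} \<rightarrow>\<^sub>E UNIV. sum g {..<m A} = \<alpha> A}))"
  define \<Phi> where "\<Phi> \<beta> = restrict (\<lambda>A. restrict (\<lambda>k. \<beta> (A, k)) {..<m A}) ?NS"
    for \<beta> :: "nat set \<times> nat \<Rightarrow> nat"
  define \<Psi> where "\<Psi> h = restrict (\<lambda>(A, k). h A k) (copies n m)"
    for h :: "nat set \<Rightarrow> nat \<Rightarrow> nat"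
  have "bij_betw \<Phi> S T"
  proof (rule bij_betw_byWitness[where f' = \<Psi>])
    show "\<forall>\<beta>\<in>S. \<Psi> (\<Phi> \<beta>) = \<beta>"
      by (auto simp: S_def \<Psi>_def \<Phi>_def copies_def fun_eq_iff PiE_def extensional_def)
    show "\<forall>h\<in>T. \<Phi> (\<Psi> h) = h"
    proof
      fix h assume h: "h \<in> T"
      have "\<Phi> (\<Psi> h) A = h A" for A
      proof (cases "A \<in> ?NS")
        case True
        then have "h A \<in> {..<m A} \<rightarrow>\<^sub>E UNIV" using h by (auto simp: T_def)
        then show ?thesis
          using True by (auto simp: \<Phi>_def \<Psi>_def copies_def fun_eq_iff PiE_def extensional_def)
      next
        case False
        then show ?thesis using h by (auto simp: \<Phi>_def T_def PiE_def extensional_def)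
      qed
      then show "\<Phi> (\<Psi> h) = h" by auto
    qed
    show "\<Phi> ` S \<subseteq> T"
      by (auto simp: S_def T_def \<Phi>_def family_sums_def PiE_def extensional_def)
    show "\<Psi> ` T \<subseteq> S"
    proof clarify
      fix h assume h: "h \<in> T"
      have "family_sums n m (\<Psi> h) A = \<alpha> A" for A
      proof (cases "A \<in> ?NS")
        case True
        then have "sum (h A) {..<m A} = \<alpha> A" using h by (auto simp: T_def)
        moreover have "(\<Sum>k<m A. \<Psi> h (A, k)) = sum (h A) {..<m A}"
          using True by (intro sum.cong) (auto simp: \<Psi>_def copies_def)
        ultimately show ?thesis using True by (simp add: family_sums_def)
      next
        case False
        then show ?thesis using \<alpha> by (auto simp: family_sums_def PiE_def extensional_def)
      qed
      then show "\<Psi> h \<in> S" by (auto simp: S_def \<Psi>_def)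
    qed
  qed
  moreover have "finite T"
    unfolding T_def using card_compositions(2) finite_nonempty_subsets by (intro finite_PiE) auto
  moreover have "card T = (\<Prod>A\<in>?NS. (m A + \<alpha> A - 1) choose \<alpha> A)"
    unfolding T_def using finite_nonempty_subsets by (simp add: card_PiE card_compositions(1))
  ultimately show "card S = (\<Prod>A\<in>?NS. (m A + \<alpha> A - 1) choose \<alpha> A)" "finite S"
    using bij_betw_same_card bij_betw_finite by metis+
qed

lemma card_degree_vectors_membership:
  "card (degree_vectors (copies n m) (membership n m)) =
    (\<Sum>\<alpha>\<in>D n. \<Prod>A\<in>nonempty_subsets n. (m A + \<alpha> A - 1) choose \<alpha> A)"
proof -
  define S where "S \<alpha> = {\<beta> \<in> copies n m \<rightarrow>\<^sub>E UNIV. family_sums n m \<beta> = \<alpha>}" for \<alpha>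
  have ext: "\<alpha> \<in> nonempty_subsets n \<rightarrow>\<^sub>E UNIV" if "\<alpha> \<in> D n" for \<alpha> using that by (simp add: D_def)
  have "degree_vectors (copies n m) (membership n m) = (\<Union>\<alpha>\<in>D n. S \<alpha>)"
    unfolding degree_vectors_membership S_def by auto
  also have "card \<dots> = (\<Sum>\<alpha>\<in>D n. card (S \<alpha>))"
    using card_family_sums_fibre(2)[OF ext] by (intro card_UN_disjoint finite_D) (auto simp: S_def)
  also have "\<dots> = (\<Sum>\<alpha>\<in>D n. \<Prod>A\<in>nonempty_subsets n. (m A + \<alpha> A - 1) choose \<alpha> A)"
    using card_family_sums_fibre(1)[OF ext] by (intro sum.cong) (auto simp: S_def)
  finally show ?thesis .
qed

text \<open>
  With the convention that sequences start at index 1, this is the inverse of the passage from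
  \<open>t (b\<^sub>1 + \<dots> + b\<^sub>m - 1)\<close> to \<open>t w\<^sub>m\<close>.
\<close>

definition binomial_transform :: "(nat \<Rightarrow> 'a::semiring_1) \<Rightarrow> nat \<Rightarrow> 'a" where
  "binomial_transform v k = (\<Sum>j<k. of_nat ((k - 1) choose j) * v (Suc j))"

lemma sum_Pow_card:
  fixes f :: "nat \<Rightarrow> nat"
  assumes "finite T"
  shows "(\<Sum>A\<in>Pow T. f (card A)) = (\<Sum>j\<le>card T. (card T choose j) * f j)"
proof -
  have "(\<Sum>A\<in>Pow T. f (card A)) = (\<Sum>j\<le>card T. \<Sum>A\<in>{A\<in>Pow T. card A = j}. f (card A))"
    using assms by (intro sum.group[symmetric]) (auto intro: card_mono)
  also have "\<dots> = (\<Sum>j\<le>card T. (card T choose j) * f j)"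
    using n_subsets[OF assms] by (intro sum.cong) auto
  finally show ?thesis .
qed

text \<open>
  The subsets of \<open>insert x T\<close> that contain \<open>x\<close> contribute exactly the next term of the transform.
\<close>

lemma sum_nonempty_Pow_card:
  fixes v :: "nat \<Rightarrow> nat"
  assumes "finite T"
  shows "(\<Sum>A\<in>Pow T - {{}}. v (card A)) = sum (binomial_transform v) {1..card T}"
  using assms
proof (induction T rule: finite_induct)
  case (insert x T)
  have inj: "inj_on (insert x) (Pow T)" using insert.hyps by (auto simp: inj_on_def)
  have split: "Pow (insert x T) - {{}} = (Pow T - {{}}) \<union> insert x ` Pow T"
    by (auto simp: Pow_insert)
  have "(\<Sum>A\<in>Pow (insert x T) - {{}}. v (card A)) =
      (\<Sum>A\<in>Pow T - {{}}. v (card A)) + (\<Sum>A\<in>insert x ` Pow T. v (card A))"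
    unfolding split using insert.hyps by (intro sum.union_disjoint) auto
  also have "(\<Sum>A\<in>insert x ` Pow T. v (card A)) = (\<Sum>A\<in>Pow T. v (Suc (card A)))"
    unfolding sum.reindex[OF inj]
  proof (intro sum.cong refl)
    fix A assume "A \<in> Pow T"
    then have "finite A" "x \<notin> A" using insert.hyps finite_subset by auto
    then show "((\<lambda>A. v (card A)) \<circ> insert x) A = v (Suc (card A))" by simp
  qed
  also have "\<dots> = binomial_transform v (Suc (card T))"
    using sum_Pow_card[OF insert.hyps(1), of "\<lambda>j. v (Suc j)"]
    by (simp add: binomial_transform_def lessThan_Suc_atMost)
  finally show ?case using insert by simp
qed simp

text \<open>
  The interval \<open>{n - s<..n}\<close> picks the \<open>s\<close> largest entries when \<open>c\<close> is nondecreasing.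
\<close>

definition weakly_majorized :: "nat \<Rightarrow> (nat \<Rightarrow> nat) \<Rightarrow> (nat \<Rightarrow> nat) set" where
  "weakly_majorized n c =
     {y \<in> {1..n} \<rightarrow>\<^sub>E UNIV. \<forall>S\<subseteq>{1..n}. sum y S \<le> sum c {n - card S<..n}}"

text \<open>
  The sets that do not meet \<open>S\<close> are the subsets of its complement, which account for the terms
  with the \<open>n - card S\<close> smallest indices.
\<close>

lemma degree_vectors_membership_converse:
  fixes v :: "nat \<Rightarrow> nat"
  defines "m \<equiv> \<lambda>A :: nat set. v (card A)"
  shows "degree_vectors {1..n} ((membership n m)\<inverse>) = weakly_majorized n (binomial_transform v)"
proof -
  have "card ((membership n m)\<inverse> `` S) = sum (binomial_transform v) {n - card S<..n}"
    if S: "S \<subseteq> {1..n}" for S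
  proof -
    let ?meet = "{A \<in> nonempty_subsets n. A \<inter> S \<noteq> {}}" and ?T = "{1..n} - S"
    have cS: "card ?T = n - card S" using S finite_subset by (subst card_Diff_subset) auto
    have "(membership n m)\<inverse> `` S = Sigma ?meet (\<lambda>A. {..<m A})"
      by (auto simp: membership_def copies_def)
    then have "card ((membership n m)\<inverse> `` S) = (\<Sum>A\<in>?meet. v (card A))"
      using finite_nonempty_subsets by (simp add: m_def)
    moreover have "(\<Sum>A\<in>?meet. v (card A)) + (\<Sum>A\<in>Pow ?T - {{}}. v (card A)) =
        (\<Sum>A\<in>nonempty_subsets n. v (card A))"
    proof (subst sum.union_disjoint[symmetric])
      have "?meet \<union> (Pow ?T - {{}}) = nonempty_subsets n" by (auto simp: nonempty_subsets_def)
      then show "(\<Sum>A\<in>?meet \<union> (Pow ?T - {{}}). v (card A)) = (\<Sum>A\<in>nonempty_subsets n. v (card A))"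
        by simp
    qed (use finite_nonempty_subsets in auto)
    moreover have "(\<Sum>A\<in>Pow ?T - {{}}. v (card A)) = sum (binomial_transform v) {1..n - card S}"
      using sum_nonempty_Pow_card[of ?T v] cS by simp
    moreover have "(\<Sum>A\<in>nonempty_subsets n. v (card A)) = sum (binomial_transform v) {1..n}"
      using sum_nonempty_Pow_card[of "{1..n}" v] by (simp add: nonempty_subsets_def)
    moreover have "sum (binomial_transform v) {1..n} = sum (binomial_transform v) {1..n - card S} +
        sum (binomial_transform v) {n - card S<..n}"
    proof -
      have "{1..n} = {1..n - card S} \<union> {n - card S<..n}" by auto
      then show ?thesis
        using sum.union_disjoint[of "{1..n - card S}" "{n - card S<..n}" "binomial_transform v"]
        by (metis (no_types, lifting) disjoint_iff atLeastAtMost_iff finite_atLeastAtMost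
            finite_greaterThanAtMost greaterThanAtMost_iff not_le)
    qed
    ultimately show ?thesis by simp
  qed
  then show ?thesis unfolding degree_vectors_def weakly_majorized_def by auto
qed

theorem card_weakly_majorized_binomial_transform:
  fixes v :: "nat \<Rightarrow> nat"
  shows "card (weakly_majorized n (binomial_transform v)) =
    (\<Sum>\<alpha>\<in>D n. \<Prod>A\<in>nonempty_subsets n. (v (card A) + \<alpha> A - 1) choose \<alpha> A)"
  using card_degree_vectors_converse[OF finite_copies finite_atLeastAtMost
      membership_subset[of n "\<lambda>A. v (card A)"]]
  unfolding card_degree_vectors_membership degree_vectors_membership_converse by (rule sym)

section \<open>Polynomial functions of finitely many variables\<close>

text \<open>
  Multiplication by a single variable instead of general products: this keeps the induction in
  \<open>polyfun_newton_expansion\<close> within reach of the two-term recurrence for binomial coefficients.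
\<close>

inductive polyfun :: "((nat \<Rightarrow> real) \<Rightarrow> real) \<Rightarrow> bool" where
  polyfun_const: "polyfun (\<lambda>_. a)"
| polyfun_add: "polyfun f \<Longrightarrow> polyfun g \<Longrightarrow> polyfun (\<lambda>x. f x + g x)"
| polyfun_var_mult: "polyfun f \<Longrightarrow> polyfun (\<lambda>x. x i * f x)"

lemma polyfun_mult: "polyfun f \<Longrightarrow> polyfun g \<Longrightarrow> polyfun (\<lambda>x. f x * g x)"
proof (induction rule: polyfun.induct)
  case (polyfun_const a)
  from polyfun_const show ?case
  proof (induction rule: polyfun.induct)
    case (polyfun_const b)
    show ?case by (rule polyfun.polyfun_const)
  next
    case (polyfun_add f g)
    then show ?case by (auto simp: distrib_left intro: polyfun.polyfun_add)
  next
    case (polyfun_var_mult f i)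
    from polyfun.polyfun_var_mult[OF this(2), of i] show ?case by (simp add: mult.left_commute)
  qed
next
  case (polyfun_add f h)
  then show ?case by (auto simp: distrib_right intro: polyfun.polyfun_add)
next
  case (polyfun_var_mult f i)
  then show ?case by (auto simp: mult.assoc intro: polyfun.polyfun_var_mult)
qed

lemma polyfun_var: "polyfun (\<lambda>x. x i)"
  using polyfun_var_mult[OF polyfun_const[of 1]] by simp

lemma polyfun_diff: "polyfun f \<Longrightarrow> polyfun g \<Longrightarrow> polyfun (\<lambda>x. f x - g x)"
  using polyfun_add[OF _ polyfun_mult[OF polyfun_const[of "-1"]], of f g] by simp

lemma polyfun_sum: "finite A \<Longrightarrow> (\<And>a. a \<in> A \<Longrightarrow> polyfun (f a)) \<Longrightarrow> polyfun (\<lambda>x. \<Sum>a\<in>A. f a x)"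
  by (induction A rule: finite_induct) (auto intro: polyfun_const polyfun_add)

lemma polyfun_compose:
  "polyfun f \<Longrightarrow> (\<And>i. polyfun (h i)) \<Longrightarrow> polyfun (\<lambda>x. f (\<lambda>i. h i x))"
  by (induction rule: polyfun.induct) (auto intro: polyfun_const polyfun_add polyfun_mult)

lemma polyfun_gbinomial: "polyfun (\<lambda>x. x i gchoose k)"
proof -
  have "polyfun (\<lambda>x. (\<Prod>j<k. x i - real j))"
  proof (induction k)
    case (Suc k)
    from polyfun_mult[OF Suc polyfun_diff[OF polyfun_var[of i] polyfun_const[of "real k"]]]
    show ?case by simp
  qed (simp add: polyfun_const)
  from polyfun_mult[OF this polyfun_const[of "1 / fact k"]] show ?thesis
    by (simp add: gbinomial_prod_rev atLeast0LessThan)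
qed

text \<open>
  A polynomial identity can thus be checked along one line, where finitely many roots suffice.
\<close>

lemma polyfun_on_line: "polyfun f \<Longrightarrow> \<exists>p. \<forall>t. f (\<lambda>i. u i + t * v i) = poly p t"
proof (induction rule: polyfun.induct)
  case (polyfun_const a)
  show ?case by (intro exI[of _ "[:a:]"]) simp
next
  case (polyfun_add f g)
  then obtain p q where "\<forall>t. f (\<lambda>i. u i + t * v i) = poly p t" "\<forall>t. g (\<lambda>i. u i + t * v i) = poly q t"
    by blast
  then show ?case by (intro exI[of _ "p + q"]) simp
next
  case (polyfun_var_mult f i)
  then obtain p where "\<forall>t. f (\<lambda>i. u i + t * v i) = poly p t" by blast
  then show ?case by (intro exI[of _ "[:u i, v i:] * p"]) (simp add: algebra_simps)
qed

text \<open>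
  The basis of binomial coefficients in one variable is chosen because its antidifferences are
  immediate.
\<close>

lemma polyfun_newton_expansion:
  assumes "polyfun f"
  shows "\<exists>N g. (\<forall>k. polyfun (g k)) \<and> (\<forall>k\<ge>N. g k = (\<lambda>_. 0)) \<and>
    (\<forall>k x t. g k (x(i := t)) = g k x) \<and> (\<forall>x. f x = (\<Sum>k<N. g k x * (x i gchoose k)))"
  using assms
proof (induction rule: polyfun.induct)
  case (polyfun_const a)
  show ?case
    by (intro exI[of _ 1] exI[of _ "\<lambda>k _. if k = 0 then a else 0"])
       (auto intro: polyfun.polyfun_const)
next
  case (polyfun_add f f')
  obtain N g where *: "\<forall>k. polyfun (g k)" "\<forall>k\<ge>N. g k = (\<lambda>_. 0)"
      "\<forall>k x t. g k (x(i := t)) = g k x" "\<forall>x. f x = (\<Sum>k<N. g k x * (x i gchoose k))"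
    using polyfun_add.IH(1) by blast
  note g = *[rule_format]
  obtain N' g' where *: "\<forall>k. polyfun (g' k)" "\<forall>k\<ge>N'. g' k = (\<lambda>_. 0)"
      "\<forall>k x t. g' k (x(i := t)) = g' k x" "\<forall>x. f' x = (\<Sum>k<N'. g' k x * (x i gchoose k))"
    using polyfun_add.IH(2) by blast
  note g' = *[rule_format]
  let ?M = "max N N'"
  have "f x = (\<Sum>k<?M. g k x * (x i gchoose k))" for x
    unfolding g(4) using g(2) by (intro sum.mono_neutral_left) auto
  moreover have "f' x = (\<Sum>k<?M. g' k x * (x i gchoose k))" for x
    unfolding g'(4) using g'(2) by (intro sum.mono_neutral_left) auto
  ultimately have "f x + f' x = (\<Sum>k<?M. (g k x + g' k x) * (x i gchoose k))" for x
    by (simp add: distrib_right sum.distrib)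
  note sum_eq = this
  show ?case
  proof (intro exI[of _ ?M] exI[of _ "\<lambda>k x. g k x + g' k x"] conjI allI impI)
    show "polyfun (\<lambda>x. g k x + g' k x)" for k using g(1) g'(1) by (rule polyfun.polyfun_add)
  qed (simp_all only: g(2,3) g'(2,3) max.bounded_iff add_0 sum_eq)
next
  case (polyfun_var_mult f j)
  obtain N g where *: "\<forall>k. polyfun (g k)" "\<forall>k\<ge>N. g k = (\<lambda>_. 0)"
    "\<forall>k x t. g k (x(i := t)) = g k x" "\<forall>x. f x = (\<Sum>k<N. g k x * (x i gchoose k))"
    using polyfun_var_mult.IH by blast
  note g = *[rule_format]
  show ?case
  proof (cases "j = i")
    case False
    show ?thesis
    proof (intro exI[of _ N] exI[of _ "\<lambda>k x. x j * g k x"] conjI allI impI)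
      show "polyfun (\<lambda>x. x j * g k x)" for k using g(1) by (rule polyfun.polyfun_var_mult)
      show "(\<lambda>x. x j * g k x) = (\<lambda>_. 0)" if "k \<ge> N" for k by (simp add: g(2)[OF that])
      show "(x(i := t)) j * g k (x(i := t)) = x j * g k x" for k x t
        using False by (simp only: g(3)) simp
      show "x j * f x = (\<Sum>k<N. x j * g k x * (x i gchoose k))" for x
        unfolding g(4) by (simp add: sum_distrib_left mult.assoc)
    qed
  next
    case True
    define h where "h k x = real k * (g (k - 1) x + g k x)" for k x
    have step: "y * (y gchoose k) = real (Suc k) * (y gchoose Suc k) + real k * (y gchoose k)"
      for y :: real and k
      using gbinomial_mult_1[of y k] by (simp add: algebra_simps)
    have "x i * f x = (\<Sum>k<Suc N. h k x * (x i gchoose k))" for x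
    proof -
      have "x i * f x = (\<Sum>k<N. g k x * (x i * (x i gchoose k)))"
        unfolding g(4) by (simp add: sum_distrib_left mult.left_commute)
      also have "\<dots> = (\<Sum>k<N. real (Suc k) * g k x * (x i gchoose Suc k)) +
          (\<Sum>k<N. real k * g k x * (x i gchoose k))"
        unfolding step by (simp add: algebra_simps sum.distrib)
      also have "(\<Sum>k<N. real (Suc k) * g k x * (x i gchoose Suc k)) =
          (\<Sum>k<Suc N. real k * g (k - 1) x * (x i gchoose k))"
        unfolding sum.lessThan_Suc_shift by simp
      also have "(\<Sum>k<N. real k * g k x * (x i gchoose k)) =
          (\<Sum>k<Suc N. real k * g k x * (x i gchoose k))"
        using g(2)[of N] by simp
      finally show ?thesis unfolding sum.distrib[symmetric] h_def by (simp add: algebra_simps)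
    qed
    note sum_eq = this
    show ?thesis unfolding True
    proof (intro exI[of _ "Suc N"] exI[of _ h] conjI allI impI)
      show "polyfun (h k)" for k
        unfolding h_def by (intro polyfun_mult polyfun_add polyfun.polyfun_const g(1))
      show "h k = (\<lambda>_. 0)" if "k \<ge> Suc N" for k
        using that g(2)[of k] g(2)[of "k - 1"] by (auto simp: h_def fun_eq_iff)
      show "h k (x(i := t)) = h k x" for k x t by (simp only: h_def g(3))
    qed (rule sum_eq)
  qed
qed

lemma polyfun_antidifference:
  assumes "polyfun f"
  obtains g where "polyfun g" "\<And>x. g (x(i := x i + 1)) - g x = f x"
proof -
  obtain N h where *: "\<forall>k. polyfun (h k)" "\<forall>k x t. h k (x(i := t)) = h k x"
    "\<forall>x. f x = (\<Sum>k<N. h k x * (x i gchoose k))"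
    using polyfun_newton_expansion[OF assms, of i] by blast
  note h = *[rule_format]
  define g where "g x = (\<Sum>k<N. h k x * (x i gchoose Suc k))" for x
  have "polyfun g"
    unfolding g_def by (intro polyfun_sum polyfun_mult h(1) polyfun_gbinomial) simp
  moreover have "g (x(i := x i + 1)) - g x = f x" for x
    unfolding g_def h(3) sum_subtractf[symmetric]
    by (simp only: fun_upd_same h(2) gbinomial_Suc_Suc distrib_left add_diff_cancel_right')
  ultimately show ?thesis using that by blast
qed

lemma sum_antidifference:
  fixes g :: "(nat \<Rightarrow> real) \<Rightarrow> real" and a b :: nat
  assumes g: "\<And>x. g (x(i := x i + 1)) - g x = f x" and "a \<le> b"
  shows "(\<Sum>j=a..<b. f (x(i := real j))) = g (x(i := real b)) - g (x(i := real a))"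
  using \<open>a \<le> b\<close>
proof (induction b rule: dec_induct)
  case (step b)
  have "g (x(i := real (Suc b))) - g (x(i := real b)) = f (x(i := real b))"
    using g[of "x(i := real b)"] by (simp add: add.commute)
  then show ?case unfolding sum.atLeastLessThan_Suc[OF step.hyps(1)] step.IH by linarith
qed simp

section \<open>Counting weakly majorized vectors\<close>

text \<open>
  Two neighbouring entries \<open>c m\<close> and \<open>c (Suc m)\<close> are replaced by the single entry \<open>j\<close>. Index 0
  is outside the range that matters, so \<open>merged 0 j c\<close> drops \<open>c 1\<close>.
\<close>

definition merged :: "nat \<Rightarrow> nat \<Rightarrow> (nat \<Rightarrow> nat) \<Rightarrow> nat \<Rightarrow> nat" where
  "merged m j c i = (if i < m then c i else if i = m then j else c (Suc i))"

text \<open>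
  Fixing one coordinate \<open>k\<close> of a weakly majorized vector leaves, for a set of \<open>s\<close> other coordinates, the
  bound by the top \<open>s\<close> entries and the bound by the top \<open>s + 1\<close> entries minus \<open>k\<close>. If \<open>k\<close> lies
  between \<open>c m\<close> and \<open>c (Suc m)\<close>, the minimum of the two is again a sum of top entries, namely after
  these two entries have been merged into one by subtracting \<open>k\<close> from their sum.
\<close>

lemma le_sum_merged_iff:
  assumes mono: "mono_on {1..Suc n} c" and m: "m \<le> n" and s: "s \<le> n"
    and k: "0 < m \<Longrightarrow> c m \<le> k" "k \<le> c (Suc m)"
  shows "q \<le> sum (merged m (c m + c (Suc m) - k) c) {n - s<..n} \<longleftrightarrow>
    q \<le> sum c {Suc n - s<..Suc n} \<and> q + k \<le> sum c {n - s<..Suc n}"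
proof -
  have last: "sum c {n - s<..Suc n} = c (Suc (n - s)) + sum c {Suc n - s<..Suc n}"
  proof -
    have "{n - s<..Suc n} = insert (Suc (n - s)) {Suc n - s<..Suc n}" using s by auto
    then show ?thesis using s by simp
  qed
  have shift: "(\<Sum>i\<in>{a<..n}. c (Suc i)) = sum c {Suc a<..Suc n}" for a
    by (rule sum.reindex_bij_witness[of _ "\<lambda>i. i - 1" Suc]) auto
  show ?thesis
  proof (cases "m \<le> n - s")
    case True
    have "sum (merged m (c m + c (Suc m) - k) c) {n - s<..n} = (\<Sum>i\<in>{n - s<..n}. c (Suc i))"
      using True by (intro sum.cong) (auto simp: merged_def)
    also have "\<dots> = sum c {Suc n - s<..Suc n}" using s shift by (simp add: Suc_diff_le)
    finally have eq: "sum (merged m (c m + c (Suc m) - k) c) {n - s<..n} = sum c {Suc n - s<..Suc n}" .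
    have "c (Suc m) \<le> c (Suc (n - s))"
      using True s by (intro mono_onD[OF mono]) auto
    then show ?thesis unfolding eq last using k by auto
  next
    case False
    then have m0: "0 < m" by simp
    let ?M = "merged m (c m + c (Suc m) - k) c"
    have "{n - s<..n} = {n - s<..<m} \<union> insert m {m<..n}" using False m by auto
    then have "sum ?M {n - s<..n} = sum ?M {n - s<..<m} + (?M m + sum ?M {m<..n})"
      by (simp add: sum.union_disjoint disjoint_iff)
    also have "sum ?M {n - s<..<m} = sum c {n - s<..<m}"
      by (intro sum.cong) (auto simp: merged_def)
    also have "sum ?M {m<..n} = sum c {Suc m<..Suc n}"
      unfolding shift[symmetric] by (intro sum.cong) (auto simp: merged_def)
    finally have 1: "sum ?M {n - s<..n} =
      sum c {n - s<..<m} + (c m + c (Suc m) - k + sum c {Suc m<..Suc n})" by (simp add: merged_def)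
    have "{n - s<..Suc n} = {n - s<..<m} \<union> insert m (insert (Suc m) {Suc m<..Suc n})"
      using False m by auto
    then have 2: "sum c {n - s<..Suc n} =
        sum c {n - s<..<m} + (c m + (c (Suc m) + sum c {Suc m<..Suc n}))"
      by (simp add: sum.union_disjoint disjoint_iff)
    have "c (Suc (n - s)) \<le> c m" using False m by (intro mono_onD[OF mono]) auto
    then have 3: "c (Suc (n - s)) \<le> k" using k m0 by simp
    have "sum ?M {n - s<..n} + k = sum c {n - s<..Suc n}" using 1 2 k by simp
    then show ?thesis using last 3 by linarith
  qed
qed

lemma weakly_majorized_extend_iff:
  assumes mono: "mono_on {1..Suc n} c" and m: "m \<le> n"
    and k: "0 < m \<Longrightarrow> c m \<le> k" "k \<le> c (Suc m)" and y: "y \<in> {1..n} \<rightarrow>\<^sub>E UNIV"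
  shows "y(Suc n := k) \<in> weakly_majorized (Suc n) c \<longleftrightarrow>
    y \<in> weakly_majorized n (merged m (c m + c (Suc m) - k) c)"
proof -
  let ?z = "y(Suc n := k)" and ?M = "merged m (c m + c (Suc m) - k) c"
  have z: "?z \<in> {1..Suc n} \<rightarrow>\<^sub>E UNIV" using y by (auto simp: PiE_def extensional_def)
  have z_without: "sum ?z S = sum y S" and z_with: "sum ?z (insert (Suc n) S) = sum y S + k"
    and card_le: "card S \<le> n" and card_with: "card (insert (Suc n) S) = Suc (card S)"
    if S: "S \<subseteq> {1..n}" for S
  proof -
    have "finite S" "Suc n \<notin> S" using S finite_subset by auto
    moreover from this show "sum ?z S = sum y S" by (intro sum.cong) auto
    ultimately show "sum ?z (insert (Suc n) S) = sum y S + k"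
      and "card (insert (Suc n) S) = Suc (card S)" by simp_all
    show "card S \<le> n" using card_mono[OF _ S] by simp
  qed
  note key = le_sum_merged_iff[OF mono m card_le k]
  show ?thesis
  proof
    assume L: "?z \<in> weakly_majorized (Suc n) c"
    have "sum y S \<le> sum ?M {n - card S<..n}" if S: "S \<subseteq> {1..n}" for S
    proof -
      have "S \<subseteq> {1..Suc n}" "insert (Suc n) S \<subseteq> {1..Suc n}" using S by auto
      then have "sum ?z S \<le> sum c {Suc n - card S<..Suc n}"
        "sum ?z (insert (Suc n) S) \<le> sum c {Suc n - card (insert (Suc n) S)<..Suc n}"
        using L unfolding weakly_majorized_def by blast+
      then show ?thesis
        unfolding z_without[OF S] z_with[OF S] card_with[OF S] diff_Suc_Suc
        using key[OF S] by blast
    qed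
    then show "y \<in> weakly_majorized n ?M" using y by (simp add: weakly_majorized_def)
  next
    assume R: "y \<in> weakly_majorized n ?M"
    have "sum ?z S \<le> sum c {Suc n - card S<..Suc n}" if S: "S \<subseteq> {1..Suc n}" for S
    proof -
      define S0 where "S0 = S - {Suc n}"
      have S0: "S0 \<subseteq> {1..n}" using S by (auto simp: S0_def)
      then have "sum y S0 \<le> sum ?M {n - card S0<..n}" using R by (auto simp: weakly_majorized_def)
      then have *: "sum y S0 \<le> sum c {Suc n - card S0<..Suc n}"
        "sum y S0 + k \<le> sum c {n - card S0<..Suc n}" using key[OF S0] by auto
      show ?thesis
      proof (cases "Suc n \<in> S")
        case True
        then have S: "S = insert (Suc n) S0" by (auto simp: S0_def)
        show ?thesis
          unfolding S z_with[OF S0] card_with[OF S0] diff_Suc_Suc by (rule *(2))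
      next
        case False
        then have S: "S = S0" by (auto simp: S0_def)
        show ?thesis unfolding S z_without[OF S0] by (rule *(1))
      qed
    qed
    then show "?z \<in> weakly_majorized (Suc n) c" using z by (simp add: weakly_majorized_def)
  qed
qed

lemma weakly_majorized_cong:
  assumes "\<And>i. i \<in> {1..n} \<Longrightarrow> c i = c' i"
  shows "weakly_majorized n c = weakly_majorized n c'"
proof -
  have "sum c {n - s<..n} = sum c' {n - s<..n}" for s
    using assms by (intro sum.cong) auto
  then show ?thesis by (simp add: weakly_majorized_def)
qed

lemma finite_weakly_majorized: "finite (weakly_majorized n c)"
proof (rule finite_subset)
  show "weakly_majorized n c \<subseteq> {1..n} \<rightarrow>\<^sub>E {..sum c {1..n}}"
  proof
    fix y assume y: "y \<in> weakly_majorized n c"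
    have "y i \<le> sum c {1..n}" if "i \<in> {1..n}" for i
    proof -
      have "sum y {i} \<le> sum c {n - card {i}<..n}"
        using y that unfolding weakly_majorized_def by blast
      also have "\<dots> \<le> sum c {1..n}" by (intro sum_mono2) auto
      finally show ?thesis by simp
    qed
    then show "y \<in> {1..n} \<rightarrow>\<^sub>E {..sum c {1..n}}"
      using y by (auto simp: weakly_majorized_def PiE_def)
  qed
qed (simp add: finite_PiE)

lemma card_weakly_majorized_slice:
  assumes "mono_on {1..Suc n} c" "m \<le> n" "0 < m \<Longrightarrow> c m \<le> k" "k \<le> c (Suc m)"
  shows "card {y \<in> weakly_majorized (Suc n) c. y (Suc n) = k} =
    card (weakly_majorized n (merged m (c m + c (Suc m) - k) c))"
proof -
  let ?M = "merged m (c m + c (Suc m) - k) c"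
  have "bij_betw (\<lambda>y. y(Suc n := k)) (weakly_majorized n ?M)
      {y \<in> weakly_majorized (Suc n) c. y (Suc n) = k}"
  proof (rule bij_betw_byWitness[where f' = "\<lambda>y. y(Suc n := undefined)"])
    show "\<forall>y\<in>weakly_majorized n ?M. (y(Suc n := k))(Suc n := undefined) = y"
      by (auto simp: weakly_majorized_def PiE_def extensional_def)
    show "\<forall>y\<in>{y \<in> weakly_majorized (Suc n) c. y (Suc n) = k}. (y(Suc n := undefined))(Suc n := k) = y"
      by auto
    show "(\<lambda>y. y(Suc n := k)) ` weakly_majorized n ?M \<subseteq>
        {y \<in> weakly_majorized (Suc n) c. y (Suc n) = k}"
    proof clarify
      fix y assume y: "y \<in> weakly_majorized n ?M"
      then have "y \<in> {1..n} \<rightarrow>\<^sub>E UNIV" by (simp add: weakly_majorized_def)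
      then show "y(Suc n := k) \<in> weakly_majorized (Suc n) c \<and> (y(Suc n := k)) (Suc n) = k"
        using y weakly_majorized_extend_iff[OF assms] by simp
    qed
    show "(\<lambda>y. y(Suc n := undefined)) ` {y \<in> weakly_majorized (Suc n) c. y (Suc n) = k} \<subseteq>
        weakly_majorized n ?M"
    proof clarify
      fix y assume y: "y \<in> weakly_majorized (Suc n) c" "k = y (Suc n)"
      let ?y = "y(Suc n := undefined)"
      have "?y \<in> {1..n} \<rightarrow>\<^sub>E UNIV"
        using y by (auto simp: weakly_majorized_def PiE_def extensional_def)
      moreover have "?y(Suc n := k) = y" using y by auto
      ultimately have "?y \<in> weakly_majorized n ?M"
        using y weakly_majorized_extend_iff[OF assms, of ?y] by simp
      then show "?y \<in> weakly_majorized n (merged m (c m + c (Suc m) - y (Suc n)) c)"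
        using y by simp
    qed
  qed
  from bij_betw_same_card[OF this] show ?thesis by (rule sym)
qed

lemma sum_atMost_split_at_levels:
  fixes h :: "nat \<Rightarrow> nat"
  assumes "mono_on {1..Suc n} c"
  shows "(\<Sum>k\<le>c (Suc n). h k) = (\<Sum>k\<le>c 1. h k) + (\<Sum>m=1..n. \<Sum>k\<in>{c m<..c (Suc m)}. h k)"
  using assms
proof (induction n)
  case (Suc n)
  have "c (Suc n) \<le> c (Suc (Suc n))" by (rule mono_onD[OF Suc.prems]) auto
  then have "{..c (Suc (Suc n))} = {..c (Suc n)} \<union> {c (Suc n)<..c (Suc (Suc n))}" by auto
  then have "(\<Sum>k\<le>c (Suc (Suc n)). h k) =
      (\<Sum>k\<le>c (Suc n). h k) + (\<Sum>k\<in>{c (Suc n)<..c (Suc (Suc n))}. h k)"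
    by (simp add: sum.union_disjoint disjoint_iff)
  moreover have "mono_on {1..Suc n} c" using Suc.prems by (rule mono_on_subset) auto
  ultimately show ?case using Suc.IH by simp
qed simp

text \<open>
  The last coordinate \<open>k\<close> is sorted in between the entries of \<open>c\<close>. The merged entry
  \<open>c m + c (Suc m) - k\<close> then runs through the same interval as \<open>k\<close>, with the ends exchanged.
\<close>

lemma card_weakly_majorized_Suc:
  assumes mono: "mono_on {1..Suc n} c"
  shows "card (weakly_majorized (Suc n) c) =
    (c 1 + 1) * card (weakly_majorized n (\<lambda>i. c (Suc i))) +
    (\<Sum>m=1..n. \<Sum>j=c m..<c (Suc m). card (weakly_majorized n (merged m j c)))"
proof -
  let ?W = "weakly_majorized (Suc n) c"
  define h where "h k = card {y \<in> ?W. y (Suc n) = k}" for k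
  have bound: "y (Suc n) \<le> c (Suc n)" if "y \<in> ?W" for y
  proof -
    have "{Suc n} \<subseteq> {1..Suc n}" by auto
    then have "sum y {Suc n} \<le> sum c {Suc n - card {Suc n}<..Suc n}"
      using that unfolding weakly_majorized_def by blast
    also have "{Suc n - card {Suc n}<..Suc n} = {Suc n}" by auto
    finally show ?thesis by simp
  qed
  have "card ?W = (\<Sum>k\<le>c (Suc n). h k)"
    using sum.group[of ?W "{..c (Suc n)}" "\<lambda>y. y (Suc n)" "\<lambda>_. 1 :: nat"] bound
    by (auto simp: h_def finite_weakly_majorized image_subset_iff)
  also have "\<dots> = (\<Sum>k\<le>c 1. h k) + (\<Sum>m=1..n. \<Sum>k\<in>{c m<..c (Suc m)}. h k)"
    by (rule sum_atMost_split_at_levels[OF mono])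
  also have "(\<Sum>k\<le>c 1. h k) = (\<Sum>k\<le>c 1. card (weakly_majorized n (\<lambda>i. c (Suc i))))"
  proof (rule sum.cong[OF refl])
    fix k assume "k \<in> {..c 1}"
    then have "h k = card (weakly_majorized n (merged 0 (c 0 + c (Suc 0) - k) c))"
      unfolding h_def by (intro card_weakly_majorized_slice[OF mono]) auto
    also have "weakly_majorized n (merged 0 (c 0 + c (Suc 0) - k) c) =
        weakly_majorized n (\<lambda>i. c (Suc i))"
      by (rule weakly_majorized_cong) (auto simp: merged_def)
    finally show "h k = card (weakly_majorized n (\<lambda>i. c (Suc i)))" .
  qed
  also have "\<dots> = (c 1 + 1) * card (weakly_majorized n (\<lambda>i. c (Suc i)))" by simp
  also have "(\<Sum>m=1..n. \<Sum>k\<in>{c m<..c (Suc m)}. h k) =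
      (\<Sum>m=1..n. \<Sum>j=c m..<c (Suc m). card (weakly_majorized n (merged m j c)))"
  proof (rule sum.cong[OF refl])
    fix m assume m: "m \<in> {1..n}"
    have "(\<Sum>k\<in>{c m<..c (Suc m)}. h k) =
        (\<Sum>k\<in>{c m<..c (Suc m)}. card (weakly_majorized n (merged m (c m + c (Suc m) - k) c)))"
      unfolding h_def using m
      by (intro sum.cong refl card_weakly_majorized_slice[OF mono]) auto
    also have "\<dots> = (\<Sum>j=c m..<c (Suc m). card (weakly_majorized n (merged m j c)))"
      by (rule sum.reindex_bij_witness[of _ "\<lambda>j. c m + c (Suc m) - j" "\<lambda>k. c m + c (Suc m) - k"])
         auto
    finally show "(\<Sum>k\<in>{c m<..c (Suc m)}. h k) =
      (\<Sum>j=c m..<c (Suc m). card (weakly_majorized n (merged m j c)))" .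
  qed
  finally show ?thesis .
qed

lemma mono_on_merged:
  assumes mono: "mono_on {1..Suc n} c" and j: "c m \<le> j" "j \<le> c (Suc m)" and m: "1 \<le> m" "m \<le> n"
  shows "mono_on {1..n} (merged m j c)"
proof (rule mono_onI)
  fix r s assume rs: "r \<in> {1..n}" "s \<in> {1..n}" "r \<le> s"
  have le: "c a \<le> c b" if "1 \<le> a" "a \<le> b" "b \<le> Suc n" for a b
    using that by (intro mono_onD[OF mono]) auto
  consider "s < m" | "r < m" "s = m" | "r < m" "m < s" | "r = m" "s = m" | "r = m" "m < s" | "m < r"
    using rs by linarith
  then show "merged m j c r \<le> merged m j c s"
  proof cases
    case 2
    then show ?thesis using rs m j le[of r m] by (simp add: merged_def)
  next
    case 5
    then show ?thesis using rs m j le[of "Suc m" "Suc s"] by (simp add: merged_def)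
  qed (use rs m le[of r s] le[of r "Suc s"] le[of "Suc r" "Suc s"] in \<open>auto simp: merged_def\<close>)
qed

text \<open>
  In the recursion all sums run over intervals between consecutive entries of \<open>c\<close>, and summing a
  polynomial over such an interval gives a polynomial in its end points. It is the same
  polynomial for all nondecreasing \<open>c\<close>.
\<close>

theorem card_weakly_majorized_polyfun:
  "\<exists>P. polyfun P \<and> (\<forall>c. mono_on {1..n} c \<longrightarrow>
     real (card (weakly_majorized n c)) = P (\<lambda>i. real (c i)))"
proof (induction n)
  case 0
  have "weakly_majorized 0 c = {\<lambda>_. undefined}" for c by (auto simp: weakly_majorized_def)
  then show ?case by (intro exI[of _ "\<lambda>_. 1"]) (auto intro: polyfun_const)
next
  case (Suc n)
  then obtain P where P: "polyfun P"
    "\<And>c. mono_on {1..n} c \<Longrightarrow> real (card (weakly_majorized n c)) = P (\<lambda>i. real (c i))" by blast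
  define f where "f m x = P (\<lambda>i. if i \<le> m then x i else x (Suc i))" for m :: nat and x :: "nat \<Rightarrow> real"
  have "polyfun (f m)" for m
  proof -
    have "polyfun (\<lambda>x. if i \<le> m then x i else x (Suc i))" for i
      by (cases "i \<le> m") (simp_all add: polyfun_var)
    then show ?thesis unfolding f_def by (rule polyfun_compose[OF P(1)])
  qed
  then have "\<exists>g. polyfun g \<and> (\<forall>x. g (x(m := x m + 1)) - g x = f m x)" for m
    using polyfun_antidifference[of "f m" m] by metis
  then obtain g where g: "\<And>m. polyfun (g m)" "\<And>m x. g m (x(m := x m + 1)) - g m x = f m x" by metis
  define Q where "Q x = (x 1 + 1) * P (\<lambda>i. x (Suc i)) +
    (\<Sum>m=1..n. g m (x(m := x (Suc m))) - g m x)" for x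
  have "polyfun (\<lambda>x. g m (x(m := x (Suc m))))" for m
  proof -
    have "polyfun (\<lambda>x. if i = m then x (Suc m) else x i)" for i
      by (cases "i = m") (simp_all add: polyfun_var)
    from polyfun_compose[OF g(1) this] show ?thesis by (simp add: fun_upd_def)
  qed
  then have "polyfun Q"
    unfolding Q_def using g(1)
    by (intro polyfun_add polyfun_mult polyfun_sum polyfun_diff polyfun_compose[OF P(1)]
        polyfun_var polyfun_const) auto
  moreover have "real (card (weakly_majorized (Suc n) c)) = Q (\<lambda>i. real (c i))"
    if mono: "mono_on {1..Suc n} c" for c
  proof -
    let ?x = "\<lambda>i. real (c i)"
    have "mono_on {1..n} (\<lambda>i. c (Suc i))"
      by (rule mono_onI) (auto intro: mono_onD[OF mono])
    note shift = P(2)[OF this]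
    have "real (\<Sum>j=c m..<c (Suc m). card (weakly_majorized n (merged m j c))) =
        g m (?x(m := ?x (Suc m))) - g m ?x" if m: "m \<in> {1..n}" for m
    proof -
      have le: "c m \<le> c (Suc m)" using m by (intro mono_onD[OF mono]) auto
      have "real (card (weakly_majorized n (merged m j c))) = f m (?x(m := real j))"
        if "j \<in> {c m..<c (Suc m)}" for j
      proof -
        have "mono_on {1..n} (merged m j c)"
          using that m by (intro mono_on_merged[OF mono]) auto
        moreover have "(\<lambda>i. real (merged m j c i)) =
            (\<lambda>i. if i \<le> m then (?x(m := real j)) i else (?x(m := real j)) (Suc i))"
          by (auto simp: merged_def fun_eq_iff)
        ultimately show ?thesis unfolding f_def using P(2) by simp
      qed
      then have "real (\<Sum>j=c m..<c (Suc m). card (weakly_majorized n (merged m j c))) =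
          (\<Sum>j=c m..<c (Suc m). f m (?x(m := real j)))" by simp
      moreover have "?x(m := ?x m) = ?x" by (rule ext) simp
      moreover have "(\<Sum>j=c m..<c (Suc m). f m (?x(m := real j))) =
          g m (?x(m := ?x (Suc m))) - g m (?x(m := ?x m))"
        by (rule sum_antidifference[where g = "g m" and f = "f m", OF g(2) le])
      ultimately show ?thesis by (simp only:)
    qed
    then show ?thesis unfolding card_weakly_majorized_Suc[OF mono] Q_def using shift
      by (simp add: distrib_right)
  qed
  ultimately show ?case by blast
qed

section \<open>The polytope of parking functions as a polymatroid\<close>

lemma sum_le_sum_top:
  fixes f :: "nat \<Rightarrow> nat"
  assumes "mono f" "T \<subseteq> {1..n}"
  shows "sum f T \<le> sum f {n - card T<..n}"
  using assms(2)
proof (induction n arbitrary: T)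
  case (Suc n)
  show ?case
  proof (cases "Suc n \<in> T")
    case True
    define T' where "T' = T - {Suc n}"
    have T': "T' \<subseteq> {1..n}" "T = insert (Suc n) T'" "Suc n \<notin> T'" using Suc.prems True by (auto simp: T'_def)
    then have "finite T'" using finite_subset by auto
    then have "card T = Suc (card T')" "sum f T = f (Suc n) + sum f T'" using T' by auto
    moreover have "{n - card T'<..Suc n} = insert (Suc n) {n - card T'<..n}" by auto
    ultimately show ?thesis using Suc.IH[OF T'(1)] by simp
  next
    case False
    then have T: "T \<subseteq> {1..n}" using Suc.prems by (auto simp: le_Suc_eq)
    then have c: "card T \<le> n" using card_mono[of "{1..n}" T] by simp
    have "sum f T \<le> (\<Sum>i\<in>{n - card T<..n}. f i)" by (rule Suc.IH[OF T])
    also have "\<dots> \<le> (\<Sum>i\<in>{n - card T<..n}. f (Suc i))"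
      by (intro sum_mono monoD[OF assms(1)]) simp
    also have "\<dots> = sum f {Suc n - card T<..Suc n}"
      using c by (intro sum.reindex_bij_witness[of _ "\<lambda>i. i - 1" Suc]) auto
    finally show ?thesis .
  qed
qed simp

text \<open>
  If the entry of index \<open>i\<close> after sorting exceeded \<open>g i\<close>, at most \<open>i\<close> entries would be bounded
  by \<open>g i\<close>, but the first \<open>i + 1\<close> entries of the original list are.
\<close>

lemma nth_sort_le:
  fixes l :: "'a::linorder list" and g :: "nat \<Rightarrow> 'a"
  assumes le: "\<And>i. i < length l \<Longrightarrow> l ! i \<le> g i" and mono: "mono g" and i: "i < length l"
  shows "sort l ! i \<le> g i"
proof (rule ccontr)
  assume "\<not> ?thesis"
  then have gt: "g i < sort l ! i" by simp
  define p where "p x \<longleftrightarrow> x \<le> g i" for x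
  have "p x" if x: "x \<in> set (take (Suc i) l)" for x
  proof -
    obtain j where "j < length l" "j < Suc i" "x = l ! j" using x by (auto simp: in_set_conv_nth)
    then show ?thesis using le[of j] monoD[OF mono, of j i] by (auto simp: p_def)
  qed
  then have "filter p (take (Suc i) l) = take (Suc i) l" by (simp add: filter_id_conv)
  moreover have "filter p l = filter p (take (Suc i) l) @ filter p (drop (Suc i) l)"
    by (metis append_take_drop_id filter_append)
  ultimately have lower: "Suc i \<le> length (filter p l)" using i by simp
  have "\<not> p x" if x: "x \<in> set (drop i (sort l))" for x
  proof -
    obtain j where "j < length l - i" "x = sort l ! (i + j)" using x by (auto simp: in_set_conv_nth)
    then have "sort l ! i \<le> x" by (auto intro!: sorted_nth_mono)
    then show ?thesis using gt by (auto simp: p_def)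
  qed
  then have "filter p (drop i (sort l)) = []" by (simp add: filter_empty_conv)
  moreover have "filter p (sort l) = filter p (take i (sort l)) @ filter p (drop i (sort l))"
    by (metis append_take_drop_id filter_append)
  ultimately have "length (filter p (sort l)) \<le> i"
    by (metis append_Nil2 length_filter_le length_take min.cobounded2 order_trans)
  moreover have "length (filter p (sort l)) = length (filter p l)"
    by (metis mset_filter mset_sort size_mset)
  ultimately show False using lower by simp
qed

lemma rearrangement_eq_sort:
  fixes \<beta> :: "nat ^ 'n::finite"
  assumes "distinct xs" "set xs = (UNIV :: 'n set)"
  shows "rearrangement \<beta> = sort (map (\<lambda>i. \<beta> $ i) xs)"
proof -
  have "mset_set (UNIV :: 'n set) = mset xs" using assms mset_set_set by metis
  then show ?thesis unfolding rearrangement_def by (metis mset_map sorted_list_of_multiset_mset)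
qed

definition partial_sums :: "(nat \<Rightarrow> nat) \<Rightarrow> nat \<Rightarrow> nat" where
  "partial_sums b m = (\<Sum>j=1..m. b j)"

lemma mono_partial_sums: "mono (partial_sums b)"
  by (rule monoI) (auto simp: partial_sums_def intro: sum_mono2)

lemma partial_sums_ge_1: "0 < b 1 \<Longrightarrow> 1 \<le> k \<Longrightarrow> 1 \<le> partial_sums b k"
  using monoD[OF mono_partial_sums, of 1 k b] by (simp add: partial_sums_def)

lemma bij_betw_nth_pred:
  assumes "distinct xs" "set xs = (UNIV :: 'n::finite set)"
  shows "bij_betw (\<lambda>k. xs ! (k - 1)) {1..CARD('n)} UNIV"
proof -
  have len: "length xs = CARD('n)" using assms distinct_card by fastforce
  have "bij_betw ((!) xs) {..<length xs} UNIV" using assms bij_betw_nth by blast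
  moreover have "bij_betw (\<lambda>k. k - 1) {1..CARD('n)} {..<CARD('n)}"
    by (rule bij_betw_byWitness[where f' = Suc]) auto
  ultimately show ?thesis using bij_betw_trans unfolding len comp_def by fastforce
qed

text \<open>
  Enumerate the coordinates in increasing order of their values. The \<open>k\<close>-th one is bounded by the \<open>k\<close>-th
  partial sum, and among sets of indices of a given size the largest indices give the largest bound.
\<close>

lemma parking_function_sum_le:
  fixes \<beta> :: "nat ^ 'n::finite" and S :: "'n set"
  assumes "parking_function b \<beta>"
  shows "(\<Sum>i\<in>S. \<beta> $ i) \<le> sum (partial_sums b) {CARD('n) - card S<..CARD('n)}"
proof -
  let ?n = "CARD('n)"
  obtain ys where ys: "set ys = (UNIV :: 'n set)" "distinct ys" using finite_distinct_list[OF finite] by blast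
  define xs where "xs = sort_key (\<lambda>i. \<beta> $ i) ys"
  have xs: "distinct xs" "set xs = UNIV" "sorted (map (\<lambda>i. \<beta> $ i) xs)"
    using ys by (simp_all add: xs_def)
  then have r: "rearrangement \<beta> = map (\<lambda>i. \<beta> $ i) xs"
    using rearrangement_eq_sort[OF xs(1,2)] by (simp add: sorted_sort_id)
  have len: "length xs = ?n" using xs distinct_card by fastforce
  define \<sigma> where "\<sigma> k = xs ! (k - 1)" for k
  have \<sigma>: "bij_betw \<sigma> {1..?n} UNIV" unfolding \<sigma>_def by (rule bij_betw_nth_pred[OF xs(1,2)])
  have le: "\<beta> $ \<sigma> k \<le> partial_sums b k" if "k \<in> {1..?n}" for k
  proof -
    have "rearrangement \<beta> ! (k - 1) \<le> (\<Sum>j=1..k. b j)"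
      using assms that unfolding parking_function_def by blast
    moreover have "rearrangement \<beta> ! (k - 1) = \<beta> $ \<sigma> k"
      using that len by (auto simp: r \<sigma>_def)
    ultimately show ?thesis by (simp only: partial_sums_def)
  qed
  define T where "T = {k \<in> {1..?n}. \<sigma> k \<in> S}"
  have T: "T \<subseteq> {1..?n}" by (auto simp: T_def)
  have inj: "inj_on \<sigma> T" using \<sigma> T by (auto simp: bij_betw_def intro: inj_on_subset)
  have S: "\<sigma> ` T = S" using \<sigma> by (force simp: T_def bij_betw_def)
  have "(\<Sum>i\<in>S. \<beta> $ i) = (\<Sum>k\<in>T. \<beta> $ \<sigma> k)" unfolding S[symmetric] by (simp add: sum.reindex[OF inj])
  also have "\<dots> \<le> sum (partial_sums b) T" using T le by (intro sum_mono) auto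
  also have "\<dots> \<le> sum (partial_sums b) {?n - card T<..?n}"
    by (rule sum_le_sum_top[OF mono_partial_sums T])
  also have "card T = card S" using card_image[OF inj] S by simp
  finally show ?thesis .
qed

lemma parking_functionI:
  fixes \<beta> :: "nat ^ 'n::finite"
  assumes xs: "distinct xs" "set xs = (UNIV :: 'n set)" and pos: "\<And>i. 0 < \<beta> $ i"
    and le: "\<And>k. k \<in> {1..CARD('n)} \<Longrightarrow> \<beta> $ (xs ! (k - 1)) \<le> partial_sums b k"
  shows "parking_function b \<beta>"
proof -
  have len: "length xs = CARD('n)" using xs distinct_card by fastforce
  have "mono (\<lambda>i. partial_sums b (Suc i))"
    by (rule monoI) (simp add: monoD[OF mono_partial_sums])
  then have "sort (map (\<lambda>i. \<beta> $ i) xs) ! i \<le> partial_sums b (Suc i)" if "i < CARD('n)" for i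
    using that len le[of "Suc _"] by (intro nth_sort_le) (auto simp: Suc_le_eq)
  then have "rearrangement \<beta> ! (k - 1) \<le> (\<Sum>j=1..k. b j)" if "k \<in> {1..CARD('n)}" for k
    using that unfolding rearrangement_eq_sort[OF xs]
    by (cases k) (auto simp: partial_sums_def)
  then show ?thesis using pos by (simp add: parking_function_def)
qed

lemma finite_parking_functions: "finite {\<beta> :: nat ^ 'n::finite. parking_function b \<beta>}"
proof (rule finite_subset)
  let ?N = "partial_sums b CARD('n)"
  show "{\<beta> :: nat ^ 'n. parking_function b \<beta>} \<subseteq> vec_lambda ` (UNIV \<rightarrow>\<^sub>E {..?N})"
  proof
    fix \<beta> :: "nat ^ 'n" assume "\<beta> \<in> {\<beta>. parking_function b \<beta>}"
    then have \<beta>: "parking_function b \<beta>" by simp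
    have "\<beta> $ i \<le> ?N" for i
    proof -
      have "{CARD('n) - 1<..CARD('n)} = {CARD('n)}" by auto
      then show ?thesis using parking_function_sum_le[OF \<beta>, of "{i}"] by simp
    qed
    then show "\<beta> \<in> vec_lambda ` (UNIV \<rightarrow>\<^sub>E {..?N})"
      by (intro image_eqI[of _ _ "vec_nth \<beta>"]) auto
  qed
  show "finite (vec_lambda ` ((UNIV :: 'n set) \<rightarrow>\<^sub>E {..?N}))"
    by (intro finite_imageI finite_PiE) auto
qed

text \<open>
  The form with the factor \<open>e m\<close> on the left is what the downward induction on \<open>m\<close> needs.
\<close>

lemma abel_summation_nonneg:
  fixes e r :: "nat \<Rightarrow> real"
  assumes mono: "\<And>k. m \<le> k \<Longrightarrow> k < n \<Longrightarrow> e k \<le> e (Suc k)"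
    and suffix: "\<And>k. m \<le> k \<Longrightarrow> k \<le> n \<Longrightarrow> 0 \<le> (\<Sum>i=k..n. r i)" and "m \<le> n"
  shows "e m * (\<Sum>i=m..n. r i) \<le> (\<Sum>i=m..n. e i * r i)"
  using \<open>m \<le> n\<close> mono suffix
proof (induction rule: inc_induct)
  case (step k)
  have split: "(\<Sum>i=k..n. f i) = f k + (\<Sum>i=Suc k..n. f i)" for f :: "nat \<Rightarrow> real"
    using step.hyps by (simp add: sum.atLeast_Suc_atMost)
  have "e k * (\<Sum>i=Suc k..n. r i) \<le> e (Suc k) * (\<Sum>i=Suc k..n. r i)"
    using step.hyps step.prems by (intro mult_right_mono) auto
  also have "\<dots> \<le> (\<Sum>i=Suc k..n. e i * r i)" using step by simp
  finally show ?case unfolding split[of r] split[of "\<lambda>i. e i * r i"] by (simp add: distrib_left)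
qed simp

definition parking_polymatroid :: "(nat \<Rightarrow> nat) \<Rightarrow> (real ^ 'n::finite) set" where
  "parking_polymatroid b = {x. (\<forall>i. 1 \<le> x $ i) \<and>
     (\<forall>S. (\<Sum>i\<in>S. x $ i) \<le> real (sum (partial_sums b) {CARD('n) - card S<..CARD('n)}))}"

text \<open>
  To maximize a linear form over the polymatroid, give the largest partial sums to the coordinates with the
  largest coefficients, and the smallest possible value 1 to those with coefficient at
  most 0. That no point \<open>z\<close> does better follows by Abel summation, because the constraints bound
  the sums of \<open>z - 1\<close> over the coordinates with the largest coefficients.
\<close>

lemma parking_polymatroid_greedy:
  fixes d z :: "real ^ 'n::finite"
  assumes z: "z \<in> parking_polymatroid b" and b1: "0 < b 1"
  obtains \<beta> :: "nat ^ 'n" where "parking_function b \<beta>"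
    "(\<Sum>i\<in>UNIV. d $ i * z $ i) \<le> (\<Sum>i\<in>UNIV. d $ i * real (\<beta> $ i))"
proof -
  let ?n = "CARD('n)"
  obtain ys where ys: "set ys = (UNIV :: 'n set)" "distinct ys" using finite_distinct_list[OF finite] by blast
  define xs where "xs = sort_key (\<lambda>i. d $ i) ys"
  have xs: "distinct xs" "set xs = UNIV" "sorted (map (\<lambda>i. d $ i) xs)"
    using ys by (simp_all add: xs_def)
  have len: "length xs = ?n" using xs distinct_card by fastforce
  define \<sigma> where "\<sigma> k = xs ! (k - 1)" for k
  have \<sigma>: "bij_betw \<sigma> {1..?n} UNIV" unfolding \<sigma>_def by (rule bij_betw_nth_pred[OF xs(1,2)])
  define pos where "pos = inv_into {1..?n} \<sigma>"
  have pos\<sigma>: "pos (\<sigma> k) = k" if "k \<in> {1..?n}" for k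
    using \<sigma> that by (simp add: pos_def bij_betw_def)
  have pos: "pos i \<in> {1..?n}" for i
    unfolding pos_def using \<sigma> by (intro inv_into_into) (auto simp: bij_betw_def)
  note B1 = partial_sums_ge_1[where b = b, OF b1]
  define \<beta> :: "nat ^ 'n" where "\<beta> = (\<chi> i. if d $ i > 0 then partial_sums b (pos i) else 1)"
  have "parking_function b \<beta>"
  proof (rule parking_functionI[OF xs(1,2)])
    show "0 < \<beta> $ i" for i using B1[of "pos i"] pos[of i] by (simp add: \<beta>_def)
    show "\<beta> $ (xs ! (k - 1)) \<le> partial_sums b k" if "k \<in> {1..?n}" for k
      using pos\<sigma>[OF that] B1[of k] that by (simp add: \<beta>_def \<sigma>_def)
  qed
  moreover have "(\<Sum>i\<in>UNIV. d $ i * (z $ i - 1)) \<le> (\<Sum>i\<in>UNIV. d $ i * (real (\<beta> $ i) - 1))"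
  proof -
    \<comment> \<open>Since \<open>z - 1 \<ge> 0\<close>, replacing negative coefficients by 0 only increases the linear form, and the
      positive parts are still nondecreasing in \<open>k\<close>.\<close>
    define e where "e k = max 0 (d $ \<sigma> k)" for k
    define r where "r k = real (partial_sums b k) - z $ \<sigma> k" for k
    have z1: "1 \<le> z $ i" for i using z by (simp add: parking_polymatroid_def)
    have emono: "e k \<le> e (Suc k)" if "1 \<le> k" "k < ?n" for k
    proof -
      have "d $ (xs ! (k - 1)) \<le> d $ (xs ! k)"
        using sorted_nth_mono[OF xs(3), of "k - 1" k] that len by simp
      then show ?thesis by (auto simp: e_def \<sigma>_def)
    qed
    have suffix: "0 \<le> (\<Sum>i=k..?n. r i)" if k: "1 \<le> k" "k \<le> ?n" for k
    proof -
      have inj: "inj_on \<sigma> {k..?n}" using \<sigma> k by (auto simp: bij_betw_def intro: inj_on_subset)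
      have "(\<Sum>i=k..?n. z $ \<sigma> i) = (\<Sum>i\<in>\<sigma> ` {k..?n}. z $ i)" by (simp add: sum.reindex[OF inj])
      also have "\<dots> \<le> real (sum (partial_sums b) {?n - card (\<sigma> ` {k..?n})<..?n})"
        using z by (simp add: parking_polymatroid_def)
      also have "{?n - card (\<sigma> ` {k..?n})<..?n} = {k..?n}" using k by (auto simp: card_image[OF inj])
      finally show ?thesis by (simp add: r_def sum_subtractf)
    qed
    have "1 \<le> ?n" by (simp add: Suc_le_eq)
    have "0 \<le> e 1 * (\<Sum>i=1..?n. r i)" using suffix[of 1] \<open>1 \<le> ?n\<close> by (simp add: e_def)
    also have "\<dots> \<le> (\<Sum>i=1..?n. e i * r i)"
      using emono suffix \<open>1 \<le> ?n\<close> by (rule abel_summation_nonneg)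
    finally have main: "0 \<le> (\<Sum>i=1..?n. e i * r i)" .
    have "(\<Sum>i\<in>UNIV. d $ i * (z $ i - 1)) = (\<Sum>k=1..?n. d $ \<sigma> k * (z $ \<sigma> k - 1))"
      by (rule sum.reindex_bij_betw[OF \<sigma>, symmetric])
    also have "\<dots> \<le> (\<Sum>k=1..?n. e k * (z $ \<sigma> k - 1))"
      using z1 by (intro sum_mono mult_right_mono) (auto simp: e_def)
    also have "\<dots> \<le> (\<Sum>k=1..?n. e k * (z $ \<sigma> k - 1)) + (\<Sum>k=1..?n. e k * r k)"
      using main by simp
    also have "\<dots> = (\<Sum>k=1..?n. e k * (real (partial_sums b k) - 1))"
      unfolding sum.distrib[symmetric] by (intro sum.cong) (auto simp: r_def algebra_simps)
    also have "\<dots> = (\<Sum>k=1..?n. d $ \<sigma> k * (real (\<beta> $ \<sigma> k) - 1))"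
      using pos\<sigma> by (intro sum.cong) (auto simp: e_def \<beta>_def)
    also have "\<dots> = (\<Sum>i\<in>UNIV. d $ i * (real (\<beta> $ i) - 1))"
      by (rule sum.reindex_bij_betw[OF \<sigma>])
    finally show ?thesis .
  qed
  then have "(\<Sum>i\<in>UNIV. d $ i * z $ i) \<le> (\<Sum>i\<in>UNIV. d $ i * real (\<beta> $ i))"
    by (simp add: right_diff_distrib sum_subtractf)
  ultimately show ?thesis using that by blast
qed

text \<open>
  A point of the polymatroid outside the polytope would be separated from it by a hyperplane, and in the
  normal direction of this hyperplane the greedy parking function is at least as far out.
\<close>

theorem parking_polytope_eq_polymatroid:
  assumes b1: "0 < b 1"
  shows "parking_polytope b = (parking_polymatroid b :: (real ^ 'n::finite) set)"
proof
  let ?V = "{(\<chi> i. real (\<beta> $ i)) | \<beta> :: nat ^ 'n. parking_function b \<beta>}"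
  have "convex (parking_polymatroid b :: (real ^ 'n) set)"
  proof (rule convexI)
    fix x y :: "real ^ 'n" and u v :: real
    assume x: "x \<in> parking_polymatroid b" and y: "y \<in> parking_polymatroid b"
      and uv: "0 \<le> u" "0 \<le> v" "u + v = 1"
    have "1 \<le> u * x $ i + v * y $ i" for i
    proof -
      have "1 \<le> x $ i" "1 \<le> y $ i" using x y by (simp_all add: parking_polymatroid_def)
      then have "u * 1 \<le> u * x $ i" "v * 1 \<le> v * y $ i"
        using uv mult_left_mono by blast+
      then show ?thesis using uv by linarith
    qed
    moreover have "(\<Sum>i\<in>S. u * x $ i + v * y $ i) \<le>
        real (sum (partial_sums b) {CARD('n) - card S<..CARD('n)})" (is "_ \<le> ?c") for S
    proof -
      have "u * (\<Sum>i\<in>S. x $ i) \<le> u * ?c" "v * (\<Sum>i\<in>S. y $ i) \<le> v * ?c"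
        using x y uv unfolding parking_polymatroid_def by (blast intro: mult_left_mono)+
      moreover have "u * ?c + v * ?c = ?c" using uv by (simp flip: distrib_right)
      ultimately show ?thesis by (simp add: sum.distrib flip: sum_distrib_left)
    qed
    ultimately show "u *\<^sub>R x + v *\<^sub>R y \<in> parking_polymatroid b"
      by (simp add: parking_polymatroid_def)
  qed
  moreover have "?V \<subseteq> parking_polymatroid b"
  proof clarify
    fix \<beta> :: "nat ^ 'n" assume \<beta>: "parking_function b \<beta>"
    then show "(\<chi> i. real (\<beta> $ i)) \<in> parking_polymatroid b"
      using parking_function_sum_le[OF \<beta>]
      by (auto simp: parking_polymatroid_def parking_function_def Suc_le_eq simp flip: of_nat_sum)
  qed
  ultimately show "parking_polytope b \<subseteq> (parking_polymatroid b :: (real ^ 'n) set)"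
    unfolding parking_polytope_def by (intro hull_minimal)
  have "?V = (\<lambda>\<beta>. \<chi> i. real (\<beta> $ i)) ` {\<beta> :: nat ^ 'n. parking_function b \<beta>}" by blast
  then have "finite ?V" by (simp add: finite_parking_functions)
  then have closed: "closed (parking_polytope b :: (real ^ 'n) set)"
    unfolding parking_polytope_def
    by (intro compact_imp_closed finite_imp_compact_convex_hull)
  show "parking_polymatroid b \<subseteq> (parking_polytope b :: (real ^ 'n) set)"
  proof
    fix z :: "real ^ 'n" assume z: "z \<in> parking_polymatroid b"
    show "z \<in> parking_polytope b"
    proof (rule ccontr)
      assume outside: "z \<notin> parking_polytope b"
      have "convex (parking_polytope b :: (real ^ 'n) set)"
        unfolding parking_polytope_def by (rule convex_convex_hull)
      from separating_hyperplane_closed_point[OF this closed outside]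
      obtain a c where a: "inner a z < c" "\<And>x. x \<in> parking_polytope b \<Longrightarrow> c < inner a x"
        by blast
      obtain \<beta> :: "nat ^ 'n" where \<beta>: "parking_function b \<beta>"
        "(\<Sum>i\<in>UNIV. (- a) $ i * z $ i) \<le> (\<Sum>i\<in>UNIV. (- a) $ i * real (\<beta> $ i))"
        using parking_polymatroid_greedy[OF z b1, of "- a"] by blast
      have "(\<chi> i. real (\<beta> $ i)) \<in> ?V" using \<beta>(1) by blast
      then have "(\<chi> i. real (\<beta> $ i)) \<in> (parking_polytope b :: (real ^ 'n) set)"
        unfolding parking_polytope_def by (rule hull_inc)
      then have "c < inner a (\<chi> i. real (\<beta> $ i))" by (rule a(2))
      then show False using a(1) \<beta>(2) by (simp add: inner_vec_def sum_negf)
    qed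
  qed
qed

theorem card_lattice_points_parking_polytope:
  assumes b1: "0 < b 1" and t: "0 < t"
  shows "card (lattice_points ((\<lambda>x. real t *\<^sub>R x) ` (parking_polytope b :: (real ^ 'n::finite) set))) =
    card (weakly_majorized CARD('n) (\<lambda>m. t * (partial_sums b m - 1)))"
proof -
  let ?n = "CARD('n)"
  define L where "L = lattice_points ((\<lambda>x. real t *\<^sub>R x) ` (parking_polytope b :: (real ^ 'n) set))"
  define W where "W = weakly_majorized ?n (\<lambda>m. t * (partial_sums b m - 1))"
  note B1 = partial_sums_ge_1[where b = b, OF b1]
  have L: "x \<in> L \<longleftrightarrow> (\<forall>i. x $ i \<in> \<int>) \<and> (\<forall>i. real t \<le> x $ i) \<and>
      (\<forall>S. (\<Sum>i\<in>S. x $ i) \<le> real (t * sum (partial_sums b) {?n - card S<..?n}))" for x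
  proof -
    have "x \<in> (\<lambda>x. real t *\<^sub>R x) ` (parking_polytope b) \<longleftrightarrow> (1 / real t) *\<^sub>R x \<in> parking_polymatroid b"
    proof -
      have "x \<in> (\<lambda>x. real t *\<^sub>R x) ` (parking_polytope b) \<longleftrightarrow> (1 / real t) *\<^sub>R x \<in> parking_polytope b"
        using t by (force simp: image_iff intro!: bexI[of _ "(1 / real t) *\<^sub>R x"])
      then show ?thesis using parking_polytope_eq_polymatroid[where 'n = 'n and b = b, OF b1] by simp
    qed
    also have "\<dots> \<longleftrightarrow> (\<forall>i. real t \<le> x $ i) \<and>
      (\<forall>S. (\<Sum>i\<in>S. x $ i) \<le> real (t * sum (partial_sums b) {?n - card S<..?n}))"
      using t by (simp add: parking_polymatroid_def field_simps flip: sum_divide_distrib)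
    finally show ?thesis by (auto simp: L_def lattice_points_def)
  qed
  have top: "t * sum (partial_sums b) {?n - s<..?n} =
      (\<Sum>m\<in>{?n - s<..?n}. t * (partial_sums b m - 1)) + t * s" if s: "s \<le> ?n" for s
  proof -
    have "t * sum (partial_sums b) {?n - s<..?n} = (\<Sum>m\<in>{?n - s<..?n}. t * (partial_sums b m - 1) + t)"
      unfolding sum_distrib_left
    proof (rule sum.cong[OF refl])
      fix m assume "m \<in> {?n - s<..?n}"
      then have "1 \<le> partial_sums b m" by (intro B1) auto
      then show "t * partial_sums b m = t * (partial_sums b m - 1) + t"
        by (simp add: right_diff_distrib')
    qed
    then show ?thesis using s by (simp add: sum.distrib mult.commute)
  qed
  obtain \<sigma> :: "nat \<Rightarrow> 'n" where \<sigma>: "bij_betw \<sigma> {1..?n} UNIV"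
    using finite_distinct_list[of "UNIV :: 'n set"] bij_betw_nth_pred by (metis finite)
  define pos where "pos = inv_into {1..?n} \<sigma>"
  have pos\<sigma>: "pos (\<sigma> k) = k" if "k \<in> {1..?n}" for k
    using \<sigma> that by (simp add: pos_def bij_betw_def)
  have \<sigma>pos: "\<sigma> (pos i) = i" and pos: "pos i \<in> {1..?n}" for i
  proof -
    have "i \<in> \<sigma> ` {1..?n}" using \<sigma> by (auto simp: bij_betw_def)
    then show "\<sigma> (pos i) = i" "pos i \<in> {1..?n}"
      unfolding pos_def by (rule f_inv_into_f, rule inv_into_into)
  qed
  define \<Phi> :: "(nat \<Rightarrow> nat) \<Rightarrow> real ^ 'n" where "\<Phi> y = (\<chi> i. real (y (pos i) + t))" for y
  define \<Psi> :: "real ^ 'n \<Rightarrow> nat \<Rightarrow> nat"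
    where "\<Psi> x = restrict (\<lambda>k. nat \<lfloor>x $ \<sigma> k\<rfloor> - t) {1..?n}" for x
  have \<Phi>_iff: "\<Phi> y \<in> L \<longleftrightarrow> y \<in> W" if y: "y \<in> {1..?n} \<rightarrow>\<^sub>E UNIV" for y
  proof -
    have "(\<Sum>i\<in>\<sigma> ` T. \<Phi> y $ i) \<le> real (t * sum (partial_sums b) {?n - card (\<sigma> ` T)<..?n}) \<longleftrightarrow>
        sum y T \<le> (\<Sum>m\<in>{?n - card T<..?n}. t * (partial_sums b m - 1))" if T: "T \<subseteq> {1..?n}" for T
    proof -
      have inj: "inj_on \<sigma> T" using \<sigma> T by (auto simp: bij_betw_def intro: inj_on_subset)
      have "card T \<le> ?n" using card_mono[OF _ T] by simp
      have "(\<Sum>i\<in>\<sigma> ` T. \<Phi> y $ i) = (\<Sum>k\<in>T. real (y k + t))"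
        unfolding sum.reindex[OF inj] using T pos\<sigma> by (intro sum.cong) (auto simp: \<Phi>_def)
      also have "\<dots> = real (sum y T + t * card T)" by (simp add: sum.distrib)
      finally show ?thesis
        unfolding card_image[OF inj] top[OF \<open>card T \<le> ?n\<close>] by (simp del: of_nat_add of_nat_mult of_nat_sum)
    qed
    moreover have "(\<forall>S. Q S) \<longleftrightarrow> (\<forall>T\<subseteq>{1..?n}. Q (\<sigma> ` T))" for Q
    proof -
      have "S = \<sigma> ` (pos ` S)" "pos ` S \<subseteq> {1..?n}" for S
        using pos by (auto simp: \<sigma>pos image_image)
      then show ?thesis by metis
    qed
    ultimately show ?thesis
      using y by (simp add: L W_def weakly_majorized_def \<Phi>_def)
  qed
  have \<Phi>\<Psi>: "\<Phi> (\<Psi> x) = x" if "x \<in> L" for x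
  proof -
    have "real (\<Psi> x (pos i) + t) = x $ i" for i
    proof -
      have "real t \<le> x $ i" "x $ i \<in> \<int>" using that L by auto
      then obtain k :: int where k: "x $ i = of_int k" by (auto elim: Ints_cases)
      then have "int t \<le> k" using \<open>real t \<le> x $ i\<close> by simp
      then show ?thesis using k pos[of i] by (simp add: \<Psi>_def \<sigma>pos)
    qed
    then show ?thesis by (simp add: \<Phi>_def vec_eq_iff)
  qed
  have "bij_betw \<Phi> W L"
  proof (rule bij_betw_byWitness[where f' = \<Psi>])
    show "\<forall>y\<in>W. \<Psi> (\<Phi> y) = y"
    proof
      fix y assume "y \<in> W"
      then have "y \<in> extensional {1..?n}" by (simp add: W_def weakly_majorized_def PiE_def)
      then show "\<Psi> (\<Phi> y) = y"
        using pos\<sigma> by (auto simp: \<Psi>_def \<Phi>_def fun_eq_iff extensional_def)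
    qed
    show "\<forall>x\<in>L. \<Phi> (\<Psi> x) = x" using \<Phi>\<Psi> by blast
    show "\<Phi> ` W \<subseteq> L" using \<Phi>_iff by (auto simp: W_def weakly_majorized_def)
    show "\<Psi> ` L \<subseteq> W"
    proof clarify
      fix x assume "x \<in> L"
      moreover have "\<Psi> x \<in> {1..?n} \<rightarrow>\<^sub>E UNIV" by (simp add: \<Psi>_def)
      ultimately show "\<Psi> x \<in> W" using \<Phi>_iff \<Phi>\<Psi> by metis
    qed
  qed
  then show ?thesis using bij_betw_same_card unfolding L_def W_def by metis
qed

section \<open>Extension to arbitrary multiplicities\<close>

text \<open>
  For \<open>m = a = 0\<close> the truncated difference on the left differs from \<open>-1\<close>, but both binomial
  coefficients are 1.
\<close>

lemma real_binomial_eq_gbinomial: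
  "real ((m + a - 1) choose a) = (real m + real a - 1) gchoose a"
proof (cases "m + a = 0")
  case False
  then obtain k where k: "m + a = Suc k" by (cases "m + a") auto
  have "real m + real a - 1 = real k" using arg_cong[OF k, of real] by simp
  then show ?thesis by (simp add: k binomial_gbinomial)
qed simp

lemma polyfun_prod: "finite A \<Longrightarrow> (\<And>a. a \<in> A \<Longrightarrow> polyfun (f a)) \<Longrightarrow> polyfun (\<lambda>x. \<Prod>a\<in>A. f a x)"
  by (induction A rule: finite_induct) (auto intro: polyfun_const polyfun_mult)

definition draconian_sum :: "nat \<Rightarrow> (nat \<Rightarrow> real) \<Rightarrow> real" where
  "draconian_sum n x =
     (\<Sum>\<alpha>\<in>D n. \<Prod>A\<in>nonempty_subsets n. (x (card A) + of_nat (\<alpha> A) - 1) gchoose \<alpha> A)"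

lemma polyfun_draconian_sum: "polyfun (draconian_sum n)"
proof -
  have gb: "polyfun (\<lambda>x. (x i + a) gchoose k)" for i k and a :: real
    using polyfun_compose[OF polyfun_gbinomial[of i k], of "\<lambda>i x. x i + a"]
      polyfun_add[OF polyfun_var polyfun_const] by simp
  have "polyfun (\<lambda>x. (x (card A) + of_nat (\<alpha> A) - 1) gchoose \<alpha> A)" for A and \<alpha> :: "nat set \<Rightarrow> nat"
    using gb[of "card A" "of_nat (\<alpha> A) - 1" "\<alpha> A"] by (simp add: add_diff_eq)
  then show ?thesis
    unfolding draconian_sum_def [abs_def]
    by (intro polyfun_sum polyfun_prod finite_D finite_nonempty_subsets)
qed

lemma card_weakly_majorized_eq_draconian_sum_nonneg:
  fixes v :: "nat \<Rightarrow> nat"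
  shows "real (card (weakly_majorized n (binomial_transform v))) = draconian_sum n (\<lambda>j. real (v j))"
  unfolding card_weakly_majorized_binomial_transform draconian_sum_def of_nat_sum of_nat_prod
    real_binomial_eq_gbinomial ..

lemma binomial_transform_const:
  assumes "1 \<le> m"
  shows "binomial_transform (\<lambda>_. s :: int) m = s * 2 ^ (m - 1)"
proof -
  have "{..<m} = {..m - 1}" using assms by auto
  then have "binomial_transform (\<lambda>_. s) m = (\<Sum>j\<le>m - 1. of_nat ((m - 1) choose j)) * s"
    by (simp add: binomial_transform_def sum_distrib_right)
  also have "(\<Sum>j\<le>m - 1. of_nat ((m - 1) choose j)) = (2 :: int) ^ (m - 1)"
    by (metis choose_row_sum of_nat_numeral of_nat_power of_nat_sum)
  finally show ?thesis by simp
qed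

lemma binomial_transform_add:
  "binomial_transform (\<lambda>j. u j + v j :: int) m = binomial_transform u m + binomial_transform v m"
  by (simp add: binomial_transform_def distrib_left sum.distrib)

lemma binomial_transform_of_nat:
  "binomial_transform (\<lambda>j. int (u j)) m = int (binomial_transform u m)"
  by (simp add: binomial_transform_def)

text \<open>
  Adding \<open>s\<close> to all \<open>v j\<close> adds \<open>s * 2 ^ (m - 1)\<close> to \<open>c m\<close> and keeps \<open>c\<close> nondecreasing. Along this
  line both sides are polynomials in \<open>s\<close>, and they agree once \<open>s\<close> is large enough to make all
  \<open>v j + s\<close> nonnegative.
\<close>

theorem card_weakly_majorized_eq_draconian_sum:
  fixes v :: "nat \<Rightarrow> int" and c :: "nat \<Rightarrow> nat"
  assumes mono: "mono_on {1..n} c"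
    and c: "\<And>m. m \<in> {1..n} \<Longrightarrow> int (c m) = binomial_transform v m"
  shows "real (card (weakly_majorized n c)) = draconian_sum n (\<lambda>j. real_of_int (v j))"
proof -
  obtain P where P: "polyfun P" "\<And>c. mono_on {1..n} c \<Longrightarrow>
      real (card (weakly_majorized n c)) = P (\<lambda>i. real (c i))"
    using card_weakly_majorized_polyfun by blast
  obtain p where p: "\<And>s. P (\<lambda>i. real (c i) + s * 2 ^ (i - 1)) = poly p s"
    using polyfun_on_line[OF P(1), of "\<lambda>i. real (c i)" "\<lambda>i. 2 ^ (i - 1)"] by blast
  obtain q where q: "\<And>s. draconian_sum n (\<lambda>j. real_of_int (v j) + s * 1) = poly q s"
    using polyfun_on_line[OF polyfun_draconian_sum, of n "\<lambda>j. real_of_int (v j)" "\<lambda>_. 1"] by blast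
  define s0 where "s0 = (\<Sum>j=1..n. nat \<bar>v j\<bar>)"
  have agree: "poly p (real s) = poly q (real s)" if s: "s0 \<le> s" for s :: nat
  proof -
    define u where "u j = (if j \<in> {1..n} then nat (v j + int s) else 0)" for j
    define cs where "cs i = c i + s * 2 ^ (i - 1)" for i
    have u: "int (u j) = v j + int s" if j: "j \<in> {1..n}" for j
    proof -
      have "nat \<bar>v j\<bar> \<le> s0" unfolding s0_def using j by (intro member_le_sum) auto
      then show ?thesis using j s by (simp add: u_def)
    qed
    have "int (cs m) = int (binomial_transform u m)" if m: "m \<in> {1..n}" for m
    proof -
      have "int (binomial_transform u m) = binomial_transform (\<lambda>j. v j + int s) m"
        unfolding binomial_transform_of_nat[symmetric] unfolding binomial_transform_def
        using u m by (intro sum.cong) auto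
      then show ?thesis
        using m c[OF m] by (simp add: binomial_transform_add binomial_transform_const cs_def)
    qed
    then have "weakly_majorized n cs = weakly_majorized n (binomial_transform u)"
      by (intro weakly_majorized_cong) simp
    then have "real (card (weakly_majorized n cs)) = draconian_sum n (\<lambda>j. real (u j))"
      by (simp add: card_weakly_majorized_eq_draconian_sum_nonneg)
    also have "\<dots> = draconian_sum n (\<lambda>j. real_of_int (v j) + real s * 1)"
      unfolding draconian_sum_def
    proof (intro sum.cong prod.cong refl)
      fix \<alpha> A assume A: "A \<in> nonempty_subsets n"
      then have "A \<subseteq> {1..n}" "A \<noteq> {}" by (auto simp: nonempty_subsets_def)
      then have "card A \<in> {1..n}"
        using card_mono[of "{1..n}" A] finite_subset[of A "{1..n}"] by (auto simp: Suc_le_eq card_gt_0_iff)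
      then have "real_of_int (int (u (card A))) = real_of_int (v (card A) + int s)" by (simp only: u)
      then show "(real (u (card A)) + of_nat (\<alpha> A) - 1) gchoose \<alpha> A =
        (real_of_int (v (card A)) + real s * 1 + of_nat (\<alpha> A) - 1) gchoose \<alpha> A" by simp
    qed
    also have "\<dots> = poly q (real s)" by (rule q)
    finally have "real (card (weakly_majorized n cs)) = poly q (real s)" .
    moreover have "mono_on {1..n} cs"
    proof (rule mono_onI)
      fix i j assume "i \<in> {1..n}" "j \<in> {1..n}" "i \<le> j"
      then show "cs i \<le> cs j"
        using mono_onD[OF mono, of i j] by (auto simp: cs_def intro!: add_mono power_increasing)
    qed
    then have "real (card (weakly_majorized n cs)) = P (\<lambda>i. real (c i) + real s * 2 ^ (i - 1))"
      using P(2) by (simp add: cs_def)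
    ultimately show ?thesis using p by simp
  qed
  have "p = q"
  proof (rule ccontr)
    assume "p \<noteq> q"
    then have "finite {x. poly (p - q) x = 0}" by (intro poly_roots_finite) simp
    moreover have "real ` {s0..} \<subseteq> {x. poly (p - q) x = 0}" using agree by auto
    ultimately have "finite (real ` {s0..})" by (rule finite_subset[rotated])
    then show False by (simp add: finite_image_iff infinite_Ici)
  qed
  then show ?thesis using p[of 0] q[of 0] P(2)[OF mono] by simp
qed

section \<open>Binomial inversion and the Ehrhart polynomial\<close>

text \<open>
  The \<open>j\<close>-th forward difference of \<open>a\<close> at 0.
\<close>

definition alternating_difference :: "(nat \<Rightarrow> int) \<Rightarrow> nat \<Rightarrow> int" where
  "alternating_difference a j = (\<Sum>i\<le>j. (-1) ^ i * int (j choose i) * a (j - i))"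

lemma alternating_difference_Suc:
  "alternating_difference a (Suc j) = alternating_difference (\<lambda>i. a (Suc i)) j - alternating_difference a j"
proof -
  have "alternating_difference a (Suc j) =
      a (Suc j) + (\<Sum>i\<le>j. (-1) ^ Suc i * int (Suc j choose Suc i) * a (j - i))"
    unfolding alternating_difference_def sum.atMost_Suc_shift by simp
  also have "(\<Sum>i\<le>j. (-1) ^ Suc i * int (Suc j choose Suc i) * a (j - i)) =
      (\<Sum>i\<le>j. (-1) ^ Suc i * int (j choose Suc i) * a (j - i)) - alternating_difference a j"
    unfolding alternating_difference_def sum_subtractf[symmetric]
    by (intro sum.cong refl) (simp add: algebra_simps)
  also have "a (Suc j) + ((\<Sum>i\<le>j. (-1) ^ Suc i * int (j choose Suc i) * a (j - i)) -
        alternating_difference a j) =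
      a (Suc j) + (\<Sum>i\<le>j. (-1) ^ Suc i * int (j choose Suc i) * a (j - i)) -
        alternating_difference a j" by simp
  also have "a (Suc j) + (\<Sum>i\<le>j. (-1) ^ Suc i * int (j choose Suc i) * a (j - i)) =
      (\<Sum>i\<le>Suc j. (-1) ^ i * int (j choose i) * a (Suc j - i))"
    unfolding sum.atMost_Suc_shift by simp
  also have "\<dots> = (\<Sum>i\<le>j. (-1) ^ i * int (j choose i) * a (Suc (j - i)))"
    by (simp add: binomial_eq_0) (intro sum.cong, auto simp: Suc_diff_le)
  finally show ?thesis by (simp add: alternating_difference_def)
qed

lemma sum_choose_Suc:
  fixes f :: "nat \<Rightarrow> int"
  shows "(\<Sum>j\<le>Suc k. int (Suc k choose j) * f j) =
    (\<Sum>j\<le>k. int (k choose j) * f j) + (\<Sum>j\<le>k. int (k choose j) * f (Suc j))"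
proof -
  have "(\<Sum>j\<le>Suc k. int (Suc k choose j) * f j) =
      (f 0 + (\<Sum>j\<le>k. int (k choose Suc j) * f (Suc j))) + (\<Sum>j\<le>k. int (k choose j) * f (Suc j))"
    unfolding sum.atMost_Suc_shift by (simp add: algebra_simps sum.distrib)
  also have "f 0 + (\<Sum>j\<le>k. int (k choose Suc j) * f (Suc j)) = (\<Sum>j\<le>Suc k. int (k choose j) * f j)"
    unfolding sum.atMost_Suc_shift by simp
  finally show ?thesis by (simp add: binomial_eq_0)
qed

text \<open>
  Newton's forward difference formula. In the induction step Pascal's rule turns the sum for \<open>Suc k\<close> into the
  sum for \<open>k\<close> of the shifted sequence.
\<close>

lemma binomial_inversion:
  "(\<Sum>j\<le>k. int (k choose j) * alternating_difference a j) = a k"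
proof (induction k arbitrary: a)
  case 0
  then show ?case by (simp add: alternating_difference_def)
next
  case (Suc k)
  have "(\<Sum>j\<le>k. int (k choose j) * alternating_difference a (Suc j)) = a (Suc k) - a k"
    unfolding alternating_difference_Suc using Suc.IH[of a] Suc.IH[of "\<lambda>i. a (Suc i)"]
    by (simp add: right_diff_distrib sum_subtractf)
  then show ?case unfolding sum_choose_Suc using Suc.IH[of a] by simp
qed

lemma w_Suc_Suc: "w b (Suc (Suc j)) = alternating_difference (\<lambda>i. int (b (Suc (Suc i)))) j"
  by (auto simp: w_def alternating_difference_def atLeast0AtMost Suc_diff_le intro!: sum.cong)

text \<open>
  The increments on both sides agree: by Pascal's rule the increment of a binomial transform is the
  transform of the shifted sequence, which inverts the alternating sums defining \<open>w\<close>.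
\<close>

lemma partial_sums_eq_binomial_transform_w:
  assumes "1 \<le> m"
  shows "int (partial_sums b m) - 1 = binomial_transform (w b) m"
proof -
  have "int (partial_sums b (Suc k)) - 1 = (\<Sum>j\<le>k. int (k choose j) * w b (Suc j))" for k
  proof (induction k)
    case 0
    then show ?case by (simp add: partial_sums_def w_def)
  next
    case (Suc k)
    have "(\<Sum>j\<le>k. int (k choose j) * w b (Suc (Suc j))) = int (b (Suc (Suc k)))"
      unfolding w_Suc_Suc by (rule binomial_inversion)
    then show ?case unfolding sum_choose_Suc Suc.IH[symmetric] by (simp add: partial_sums_def)
  qed
  from this[of "m - 1"] show ?thesis
    using assms by (simp add: binomial_transform_def flip: lessThan_Suc_atMost)
qed

theorem theorem5p9:
  fixes b :: "nat \<Rightarrow> nat"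
  assumes b_pos: "\<And>i. i \<in> {1..CARD('n::finite)} \<Longrightarrow> 0 < b i"
  shows "is_ehrhart_poly (parking_polytope b :: (real ^ 'n) set)
           (ehrhart_poly (parking_polytope b :: (real ^ 'n) set)) \<and>
         (\<forall>t::real. poly (ehrhart_poly (parking_polytope b :: (real ^ 'n) set)) t =
           (\<Sum>\<alpha>\<in>D CARD('n). \<Prod>A\<in>nonempty_subsets CARD('n).
              (of_int (w b (card A)) * t + of_nat (\<alpha> A) - 1) gchoose \<alpha> A))"
proof -
  let ?P = "parking_polytope b :: (real ^ 'n) set"
  have b1: "0 < b 1" by (rule b_pos) (simp add: Suc_le_eq)
  note B1 = partial_sums_ge_1[where b = b, OF b1]
  obtain p where p: "\<And>t. draconian_sum CARD('n) (\<lambda>j. 0 + t * real_of_int (w b j)) = poly p t"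
    using polyfun_on_line[OF polyfun_draconian_sum, of _ "\<lambda>_. 0" "\<lambda>j. real_of_int (w b j)"] by blast
  have "is_ehrhart_poly ?P p"
    unfolding is_ehrhart_poly_def
  proof (intro allI impI)
    fix t :: nat assume t: "0 < t"
    define c where "c m = t * (partial_sums b m - 1)" for m
    have "mono_on {1..CARD('n)} c"
      by (rule mono_onI) (auto simp: c_def intro!: diff_le_mono monoD[OF mono_partial_sums])
    moreover have "int (c m) = binomial_transform (\<lambda>j. int t * w b j) m" if "m \<in> {1..CARD('n)}" for m
    proof -
      have "int (c m) = int t * (int (partial_sums b m) - 1)"
        using that B1[of m] by (simp add: c_def of_nat_diff)
      also have "int (partial_sums b m) - 1 = binomial_transform (w b) m"
        using that by (intro partial_sums_eq_binomial_transform_w) auto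
      finally show ?thesis by (simp add: binomial_transform_def sum_distrib_left mult.left_commute)
    qed
    ultimately have "real (card (weakly_majorized CARD('n) c)) =
        draconian_sum CARD('n) (\<lambda>j. real_of_int (int t * w b j))"
      by (rule card_weakly_majorized_eq_draconian_sum)
    then show "poly p (real t) = real (card (lattice_points ((\<lambda>x. real t *\<^sub>R x) ` ?P)))"
      unfolding card_lattice_points_parking_polytope[where b = b, OF b1 t] c_def [abs_def] p[symmetric] by simp
  qed
  moreover from this have "ehrhart_poly ?P = p" by (rule ehrhart_poly_eqI)
  moreover have "poly p t = (\<Sum>\<alpha>\<in>D CARD('n). \<Prod>A\<in>nonempty_subsets CARD('n).
      (of_int (w b (card A)) * t + of_nat (\<alpha> A) - 1) gchoose \<alpha> A)" for t
    unfolding p[symmetric] draconian_sum_def by (simp only: add_0_left mult.commute[of t])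
  ultimately show ?thesis by simp
qed

end
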